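(* Let $p$ be a prime and $q=p^f$ with $f\ge 2$, and assume that $n=\frac{q-1}{p-1}$ is prime. Let $\chi$ and $\chi'$ be multiplicative characters on $\mathbb{F}_q^\times$. If $G(\chi\,\widehat{\eta})=G(\chi'\,\widehat{\eta})$ for all multiplicative characters $\eta$ on $\mathbb{F}_p^\times$, then $\chi$ and $\chi'$ are Frobenius-conjugate.
   Context: Let $\mu_n$ denote the group of $n$-th roots of unity. Fix a generator $\zeta_p$ of $\mu_p$ and the additive character $\psi:\mathbb{F}_q\to\mu_p$, $\psi(a)=\zeta_p^{\operatorname{Tr}(a)}$, where $\operatorname{Tr}:\mathbb{F}_q\to\mathbb{F}_p$ is the trace. The Gauss sum of a multiplicative character $\chi:\mathbb{F}_q^\times\to\mu_{q-1}$ is $G(\chi)=\sum_{a\in\mathbb{F}_q^\times}\chi(a)\psi(a)\in\mathbb{Z}[\mu_{q-1},\mu_p]$. Two characters $\chi,\chi'$ are Frobenius-conjugate if $\chi'(a)=\chi(\sigma(a))$ for some $\sigma\in\operatorname{Gal}(\mathbb{F}_q/\mathbb{F}_p)$, i.e. $\chi'=\chi^{p^j}$ for some integer $j\ge 0$. For a character $\eta:\mathbb{F}_p^\times\to\mu_{p-1}$, $\widehat{\eta}=\eta\circ N$ is its lift to $\mathbb{F}_q^\times$ via the norm $N:\mathbb{F}_q^\times\to\mathbb{F}_p^\times$, and $\chi\,\widehat{\eta}$ is the pointwise product of characters. *)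

theory Defs
  imports Complex_Main "HOL-Library.Cardinality" "HOL-Computational_Algebra.Primes"
begin

definition roots_of_unity :: "nat \<Rightarrow> complex set" where
  "roots_of_unity n = {z. z ^ n = 1}"

text \<open>
  A finite field \<open>\<bbbF>\<^sub>q\<close> is a type \<open>'a\<close> of sort \<open>{field, finite}\<close>, and \<open>\<bbbF>\<^sub>p\<close> is its prime subfield.
  In positive characteristic the natural number multiples of \<open>1\<close> already form a field.
\<close>

definition prime_subfield :: "'a::{field, finite} set" where
  "prime_subfield = range of_nat"

definition Gal :: "('a::{field, finite} \<Rightarrow> 'a) set" where
  "Gal = {\<sigma>. bij \<sigma> \<and> (\<forall>x y. \<sigma> (x + y) = \<sigma> x + \<sigma> y) \<and> (\<forall>x y. \<sigma> (x * y) = \<sigma> x * \<sigma> y) \<and>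
             (\<forall>x \<in> prime_subfield. \<sigma> x = x)}"

definition field_trace :: "'a::{field, finite} \<Rightarrow> 'a" where
  "field_trace a = (\<Sum>\<sigma> \<in> Gal. \<sigma> a)"

definition field_norm :: "'a::{field, finite} \<Rightarrow> 'a" where
  "field_norm a = (\<Prod>\<sigma> \<in> Gal. \<sigma> a)"

text \<open>
  A multiplicative character of a subfield \<open>K\<close> is a homomorphism from \<open>K - {0}\<close> to the roots of
  unity of order dividing \<open>card K - 1\<close>. It is represented by a function on the whole type whose
  values outside \<open>K - {0}\<close> are irrelevant.
\<close>

definition mult_char :: "'a::{field, finite} set \<Rightarrow> ('a \<Rightarrow> complex) \<Rightarrow> bool" where
  "mult_char K chi \<longleftrightarrow>
     (\<forall>a \<in> K - {0}. chi a \<in> roots_of_unity (card K - 1)) \<and>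
     (\<forall>a \<in> K - {0}. \<forall>b \<in> K - {0}. chi (a * b) = chi a * chi b)"

text \<open>
  The exponent in \<open>\<zeta> ^ Tr a\<close> is the least natural number representing the element \<open>Tr a\<close> of the
  prime subfield. For a \<open>p\<close>-th root of unity \<open>\<zeta>\<close> any other representative gives the same value.
\<close>

definition add_char :: "complex \<Rightarrow> 'a::{field, finite} \<Rightarrow> complex" where
  "add_char \<zeta> a = \<zeta> ^ (LEAST k. of_nat k = field_trace a)"

definition gauss_sum :: "complex \<Rightarrow> ('a::{field, finite} \<Rightarrow> complex) \<Rightarrow> complex" where
  "gauss_sum \<zeta> chi = (\<Sum>a \<in> UNIV - {0}. chi a * add_char \<zeta> a)"

definition norm_lift :: "('a::{field, finite} \<Rightarrow> complex) \<Rightarrow> 'a \<Rightarrow> complex" where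
  "norm_lift \<eta> = \<eta> \<circ> field_norm"

definition frobenius_conjugate ::
    "('a::{field, finite} \<Rightarrow> complex) \<Rightarrow> ('a \<Rightarrow> complex) \<Rightarrow> bool" where
  "frobenius_conjugate chi chi' \<longleftrightarrow> (\<exists>\<sigma> \<in> Gal. \<forall>a \<in> UNIV - {0}. chi' a = chi (\<sigma> a))"

end

theory Submission
  imports Defs "HOL-Computational_Algebra.Polynomial" "HOL-Number_Theory.Residues"
begin

text \<open>
  Let \<open>H\<close> be the kernel of the norm, cyclic of prime order \<open>n\<close>. As \<open>n\<close> is prime to \<open>p - 1\<close>, the group
  \<open>\<bbbF>\<^sub>q\<^sup>\<times>\<close> is the product of \<open>H\<close> and \<open>\<bbbF>\<^sub>p\<^sup>\<times>\<close>. Orthogonality over \<open>\<eta>\<close> turns the hypothesis into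
  \<open>\<chi>(b) S(b) = \<chi>'(b) S'(b)\<close> for \<open>b \<in> \<bbbF>\<^sub>p\<^sup>\<times>\<close>, where \<open>S(b) = \<Sum>h\<in>H. \<chi>(h) \<psi>(b h)\<close> is a sum of \<open>n p\<close>-th roots
  of unity. Since \<open>S(1) = S'(1)\<close>, Galois conjugation gives \<open>S(b) = S'(b)\<close>, and \<open>S(b)\<close> does not vanish,
  so \<open>\<chi>\<close> and \<open>\<chi>'\<close> agree on \<open>\<bbbF>\<^sub>p\<^sup>\<times>\<close>. Fourier inversion over the conjugates of \<open>S(1) = S'(1)\<close> shows that
  the restrictions to \<open>H\<close> are both trivial, or \<open>\<chi>' = \<chi>\<^sup>j\<close> on \<open>H\<close> with \<open>Tr(h\<^sup>j) = Tr(h)\<close> for all \<open>h \<in> H\<close>. In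
  the latter case both sides are sums of characters of \<open>H\<close>, and their independence forces \<open>j\<close> to
  be a power of \<open>p\<close> modulo \<open>n\<close>.
\<close>


hide_const (open) Module.smult up_ring.monom up_ring.coeff

subsection \<open>Conjugation of sums of roots of unity\<close>

text \<open>Coefficients stay integral, so that Gauss's lemma and congruences modulo a prime apply
  to relations between powers of \<open>z\<close>.\<close>

definition int_eval :: "complex \<Rightarrow> int poly \<Rightarrow> complex" where
  "int_eval z P = poly (map_poly of_int P) z"

lemma int_eval_0 [simp]: "int_eval z 0 = 0"
  by (simp add: int_eval_def)

lemma int_eval_pCons [simp]: "int_eval z (pCons a P) = of_int a + z * int_eval z P"
  by (simp add: int_eval_def map_poly_pCons)

lemma int_eval_1 [simp]: "int_eval z 1 = 1"
  by (simp add: int_eval_def)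

lemma int_eval_add [simp]: "int_eval z (P + Q) = int_eval z P + int_eval z Q"
proof -
  have "map_poly of_int (P + Q) = (map_poly of_int P + map_poly of_int Q :: complex poly)"
    by (intro poly_eqI) (simp add: coeff_map_poly)
  then show ?thesis by (simp add: int_eval_def)
qed

lemma int_eval_smult [simp]: "int_eval z (smult c P) = of_int c * int_eval z P"
  by (simp add: int_eval_def map_poly_smult)

lemma int_eval_minus [simp]: "int_eval z (- P) = - int_eval z P"
  using int_eval_smult[of z "-1" P] by simp

lemma int_eval_diff [simp]: "int_eval z (P - Q) = int_eval z P - int_eval z Q"
  using int_eval_add[of z P "-Q"] by simp

lemma int_eval_mult [simp]: "int_eval z (P * Q) = int_eval z P * int_eval z Q"
  by (induction P) (simp_all add: algebra_simps)

lemma int_eval_power [simp]: "int_eval z (P ^ n) = int_eval z P ^ n"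
  by (induction n) simp_all

lemma int_eval_monom [simp]: "int_eval z (monom c n) = of_int c * z ^ n"
  by (simp add: int_eval_def map_poly_monom poly_monom)

lemma int_eval_sum [simp]: "int_eval z (\<Sum>i\<in>I. P i) = (\<Sum>i\<in>I. int_eval z (P i))"
  by (induction I rule: infinite_finite_induct) simp_all

lemma int_eval_pcompose [simp]: "int_eval z (pcompose P Q) = int_eval (int_eval z Q) P"
  by (induction P) (simp_all add: pcompose_pCons)

text \<open>An annihilator of least degree is made primitive. Gauss's lemma then removes the
  denominators of polynomial division, so the annihilator is principal over the integers and not
  only over the rationals.\<close>

lemma ex_generator_int_annihilator:
  fixes z :: complex
  assumes "m > 0" "z ^ m = 1"
  obtains f where "int_eval z f = 0" "degree f > 0"
    "\<And>F. int_eval z F = 0 \<Longrightarrow> f dvd F"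
proof -
  define A where "A = {f. f \<noteq> 0 \<and> int_eval z f = 0}"
  have "monom 1 m - 1 \<in> A"
  proof -
    have "coeff (monom 1 m - 1 :: int poly) m \<noteq> coeff 0 m"
      using assms by simp
    then have "monom 1 m - 1 \<noteq> (0 :: int poly)" by metis
    then show ?thesis using assms by (simp add: A_def del: right_minus_eq)
  qed
  then obtain f0 where f0: "f0 \<in> A" and min0: "\<And>g. g \<in> A \<Longrightarrow> degree f0 \<le> degree g"
    using exists_least_iff[of "\<lambda>d. \<exists>f\<in>A. degree f = d"] by (metis not_le_imp_less)
  define f where "f = primitive_part f0"
  have f0_eq: "f0 = smult (content f0) f"
    by (simp add: f_def)
  have f_ne: "f \<noteq> 0" and f_root: "int_eval z f = 0" and f_prim: "content f = 1"
    and f_deg: "degree f = degree f0"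
  proof -
    have "content f0 \<noteq> 0" using f0 by (simp add: A_def)
    moreover have "of_int (content f0) * int_eval z f = 0"
      using f0 f0_eq by (metis (mono_tags, lifting) A_def int_eval_smult mem_Collect_eq)
    ultimately show "int_eval z f = 0" by simp
  qed (use f0 in \<open>auto simp: A_def f_def\<close>)
  have f_dvd: "f dvd F" if F: "int_eval z F = 0" for F
  proof -
    obtain q r where qr: "pseudo_divmod F f = (q, r)" by fastforce
    define c where "c = coeff f (degree f) ^ (Suc (degree F) - degree f)"
    have eq: "smult c F = f * q + r" and r: "r = 0 \<or> degree r < degree f"
      using pseudo_divmod[OF f_ne qr] by (auto simp: c_def)
    have "int_eval z r = 0"
      using F f_root arg_cong[OF eq, of "int_eval z"] by simp
    then have "r = 0"
      using r min0[of r] f_deg by (fastforce simp: A_def)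
    then have eq': "smult c F = f * q" using eq by simp
    have "c \<noteq> 0" using f_ne by (simp add: c_def)
    \<comment> \<open>Since \<open>f\<close> is primitive, \<open>c\<close> divides all coefficients
      of \<open>q\<close> and can be cancelled.\<close>
    have "content (smult c F) = content q"
      unfolding eq' by (simp add: content_mult f_prim)
    then have "normalize c * content F = content q" by simp
    then have "c dvd content q" by (metis dvd_triv_left normalize_dvd_iff)
    then have "[:c:] dvd q" by (simp add: const_poly_dvd_iff_dvd_content)
    then obtain q' where "q = smult c q'" by (auto simp: dvd_def)
    then have "smult c (F - f * q') = 0" using eq' by (simp add: smult_diff_right)
    then show ?thesis using \<open>c \<noteq> 0\<close> by simp
  qed
  have "degree f > 0"
  proof (rule ccontr)
    assume "\<not> ?thesis"
    then obtain a where "f = [:a:]" by (metis degree_eq_zeroE gr0I)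
    then show False using f_root f_ne by simp
  qed
  with f_root f_dvd that show ?thesis by blast
qed

text \<open>The inner binomial coefficients are multiples of \<open>l\<close>. Divisibility takes
  the place of equality because the target is \<open>int poly\<close>, of characteristic
  zero.\<close>

lemma prime_dvd_freshmans_dream:
  fixes x y :: "'a :: comm_ring_1"
  assumes "prime l"
  shows "of_nat l dvd (x + y) ^ l - (x ^ l + y ^ l)"
proof -
  have "l > 0" using assms prime_gt_0_nat by blast
  let ?t = "\<lambda>k. of_nat (l choose k) * x ^ k * y ^ (l - k)"
  have "(x + y) ^ l = (\<Sum>k\<le>l. ?t k)"
    by (rule binomial_ring)
  also have "\<dots> = (\<Sum>k\<in>{0,l}. ?t k) + (\<Sum>k\<in>{..l} - {0,l}. ?t k)"
    by (subst sum.subset_diff[of "{0,l}"]) (auto simp: add_ac)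
  also have "(\<Sum>k\<in>{0,l}. ?t k) = x ^ l + y ^ l"
    using \<open>l > 0\<close> by (simp add: add_ac)
  finally have "(x + y) ^ l - (x ^ l + y ^ l) = (\<Sum>k\<in>{..l} - {0,l}. ?t k)"
    by simp
  also have "of_nat l dvd \<dots>"
  proof (intro dvd_sum dvd_mult2)
    fix k assume "k \<in> {..l} - {0, l}"
    then have "l dvd (l choose k)"
      using assms \<open>l > 0\<close> by (intro dvd_choose_prime) auto
    then show "of_nat l dvd (of_nat (l choose k) :: 'a)"
      by (metis dvd_def of_nat_mult)
  qed
  finally show ?thesis .
qed

lemma fermat_int:
  assumes "prime l"
  shows "int l dvd a ^ l - a"
proof (cases "int l dvd a")
  case True
  then show ?thesis using assms prime_gt_0_nat by (intro dvd_diff dvd_trans[OF True dvd_power]) auto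
next
  case False
  then have "coprime (int l) a"
    using assms by (simp add: prime_imp_coprime)
  \<comment> \<open>\<open>fermat_theorem\<close> speaks of natural numbers, hence the residue
    \<open>b\<close> of \<open>a\<close>.\<close>
  moreover define b where "b = nat (a mod int l)"
  have b: "int b = a mod int l" using assms prime_gt_0_nat[of l] by (simp add: b_def)
  then have "[int b = a] (mod int l)" by (simp add: cong_def)
  then have "coprime (int l) (int b)"
    using calculation cong_imp_coprime cong_sym coprime_commute by blast
  then have "\<not> l dvd b"
    using assms by (metis coprime_absorb_left coprime_int_iff not_prime_unit)
  then have "[b ^ (l - 1) = 1] (mod l)" using assms fermat_theorem by blast
  then have "[b ^ (l - 1) * b = 1 * b] (mod l)" by (rule cong_scalar_right)
  then have "[b ^ l = b] (mod l)" using assms prime_gt_0_nat[of l] by (simp flip: power_Suc2)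
  then have "[int b ^ l = int b] (mod int l)" by (metis cong_int_iff of_nat_power)
  then have "[a ^ l = a] (mod int l)"
    using \<open>[int b = a] (mod int l)\<close> by (meson cong_pow cong_sym cong_trans)
  then show ?thesis by (simp add: cong_iff_dvd_diff)
qed

text \<open>Induction on the coefficients: Freshman's dream splits off the constant term, and
  Fermat's little theorem handles that term.\<close>

lemma int_poly_frobenius:
  fixes P :: "int poly"
  assumes "prime l"
  shows "of_nat l dvd pcompose P (monom 1 l) - P ^ l"
proof (induction P)
  case 0
  show ?case using assms prime_gt_0_nat by (simp add: power_0_left)
next
  case (pCons a P)
  define X :: "int poly" where "X = [:0, 1:]"
  have Xl: "monom 1 l = X ^ l" by (simp add: X_def monom_altdef)
  have *: "pCons a P = [:a:] + X * P" by (simp add: X_def)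
  have pX: "pcompose X Q = Q" for Q by (simp add: X_def pcompose_pCons)
  have "(of_nat l :: int poly) dvd (pcompose P (monom 1 l) - P ^ l) * X ^ l"
    using pCons.IH by (rule dvd_mult2)
  moreover have "(of_nat l :: int poly) dvd ([:a:] + X * P) ^ l - ([:a:] ^ l + (X * P) ^ l)"
    using assms by (rule prime_dvd_freshmans_dream)
  moreover have "of_nat l dvd [:a:] ^ l - [:a:]"
    using fermat_int[OF assms, of a]
    by (simp add: of_nat_poly poly_const_pow const_poly_dvd_iff_dvd_content)
  ultimately have "(of_nat l :: int poly) dvd (pcompose P (monom 1 l) - P ^ l) * X ^ l
      - (([:a:] + X * P) ^ l - ([:a:] ^ l + (X * P) ^ l)) - ([:a:] ^ l - [:a:])"
    by (intro dvd_diff[OF dvd_diff])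
  also have "\<dots> = pcompose (pCons a P) (monom 1 l) - pCons a P ^ l"
    unfolding * by (simp add: pcompose_pCons pcompose_add pcompose_mult Xl pX algebra_simps)
  finally show ?case .
qed

text \<open>
  Dedekind's argument: let \<open>f\<close> generate the annihilator of \<open>z\<close> and \<open>X\<^sup>m - 1 = f g\<close>. If \<open>f\<close> did not
  vanish at \<open>w = z\<^sup>l\<close>, then \<open>g(w) = 0\<close>, so differentiating would give \<open>m w\<^sup>m\<^sup>-\<^sup>1 = f(w) g'(w)\<close>, where
  \<open>l\<close> divides \<open>f(w)\<close> because \<open>f(X\<^sup>l)\<close> is congruent to \<open>f(X)\<^sup>l\<close> modulo \<open>l\<close>.
\<close>

lemma int_eval_root_of_unity_prime_power:
  assumes z: "m > 0" "z ^ m = 1" and l: "prime l" "\<not> l dvd m"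
    and F: "int_eval z F = 0"
  shows "int_eval (z ^ l) F = 0"
proof -
  obtain f where f: "int_eval z f = 0" "degree f > 0"
    and dvd: "\<And>F. int_eval z F = 0 \<Longrightarrow> f dvd F"
    using ex_generator_int_annihilator[OF z] by metis
  have "f dvd monom 1 m - 1" using z by (intro dvd) simp
  then obtain g where g: "monom 1 m - 1 = f * g" by (auto simp: dvd_def)
  have "int_eval (z ^ l) f = 0"
  proof (rule ccontr)
    assume ne: "int_eval (z ^ l) f \<noteq> 0"
    define w where "w = z ^ l"
    have wm: "w ^ m = 1" using z by (metis w_def mult.commute power_mult power_one)
    have "int_eval w f * int_eval w g = int_eval w (monom 1 m - 1)"
      by (simp add: g)
    also have "\<dots> = 0" by (simp add: wm)
    finally have gw: "int_eval w g = 0" using ne by (simp add: w_def)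
    obtain h where h: "pcompose f (monom 1 l) - f ^ l = of_nat l * h"
      using int_poly_frobenius[OF l(1), of f] by (auto simp: dvd_def)
    have "int_eval z (pcompose f (monom 1 l) - f ^ l) = int_eval w f"
      using f l prime_gt_0_nat[of l] by (simp add: w_def power_0_left)
    then have fw: "int_eval w f = of_nat l * int_eval z h"
      unfolding h by (simp add: of_nat_poly)
    have "int_eval w (pderiv (monom 1 m - 1)) = int_eval w f * int_eval w (pderiv g)"
      unfolding g pderiv_mult by (simp add: gw)
    then have "of_nat m * w ^ (m - 1) = of_nat l * (int_eval z h * int_eval w (pderiv g))"
      by (simp add: pderiv_diff pderiv_monom fw)
    then have "of_nat m * w ^ (m - 1) * w = of_nat l * (int_eval z h * int_eval w (pderiv g)) * w"
      by simp
    moreover have "w ^ (m - 1) * w = 1" using wm z by (simp flip: power_Suc2)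
    ultimately have m: "of_nat m = of_nat l * (int_eval z h * int_eval w (pderiv g) * w)"
      by (metis mult.assoc mult.right_neutral)
    \<comment> \<open>The other factors are integral polynomials in \<open>z\<close> too, so
      \<open>m\<close> is \<open>l\<close> times the value at \<open>z\<close> of one integral
      polynomial.\<close>
    define H where "H = h * pcompose (pderiv g) (monom 1 l) * monom 1 l"
    have H: "of_nat m = of_nat l * int_eval z H"
      by (simp add: m H_def w_def)
    \<comment> \<open>\<open>f\<close> divides a monic integral polynomial, so pseudo-division by
      \<open>f\<close> only introduces the unit \<open>c\<close>.\<close>
    have unit: "is_unit (lead_coeff f)"
    proof -
      have lc: "lead_coeff (monom 1 m - 1 :: int poly) = 1"
        using z degree_add_eq_left[of "-1" "monom 1 m :: int poly"] by (simp add: degree_monom_eq)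
      show ?thesis by (metis dvdI g lc lead_coeff_mult)
    qed
    have f_ne: "f \<noteq> 0" using f by auto
    obtain q r where qr: "pseudo_divmod H f = (q, r)" by fastforce
    define c where "c = lead_coeff f ^ (Suc (degree H) - degree f)"
    have "is_unit c" using unit by (simp add: c_def power_abs)
    have eq: "smult c H = f * q + r" and r: "r = 0 \<or> degree r < degree f"
      using pseudo_divmod[OF f_ne qr] by (simp_all add: c_def)
    have "of_int c * int_eval z H = int_eval z r"
      using f(1) arg_cong[OF eq, of "int_eval z"] by simp
    then have "int_eval z (smult (int l) r - [:c * int m:]) = 0"
      using H by (simp add: algebra_simps)
    \<comment> \<open>Below the degree of \<open>f\<close> the only annihilator is zero. Hence
      \<open>l\<close> divides \<open>c * m\<close>, where \<open>c\<close> is a unit.\<close>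
    then have "f dvd smult (int l) r - [:c * int m:]" by (rule dvd)
    moreover have "degree (smult (int l) r - [:c * int m:]) < degree f"
      using r f(2) by (intro degree_diff_less) (auto intro: le_less_trans[OF degree_smult_le])
    ultimately have "smult (int l) r - [:c * int m:] = 0"
      using dvd_imp_degree_le leD by blast
    then have "[:int l:] dvd [:c * int m:]" 
      by (intro dvdI[of _ _ r]) simp
    then have "int l dvd c * int m" by simp
    then have "int l dvd int m" using \<open>is_unit c\<close> by (simp add: dvd_mult_unit_iff')
    then show False using l by simp
  qed
  moreover obtain k where "F = f * k" using dvd[OF F] by (auto simp: dvd_def)
  ultimately show ?thesis by simp
qed

text \<open>The prime case is applied once for each prime factor of \<open>e\<close>. No such factor
  divides \<open>m\<close>, and every intermediate power of \<open>z\<close> is again an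
  \<open>m\<close>-th root of unity.\<close>

lemma int_eval_root_of_unity_power:
  assumes "m > 0" "z ^ m = 1" "coprime e m" "e > 0" "int_eval z F = 0"
  shows "int_eval (z ^ e) F = 0"
  using assms(3,4)
proof (induction e rule: prime_divisors_induct)
  case (factor l e)
  have "coprime e m" "coprime l m" "e > 0" using factor.prems by auto
  then have "int_eval (z ^ e) F = 0" using factor.IH by simp
  moreover have "(z ^ e) ^ m = 1"
    using assms(2) by (metis mult.commute power_mult power_one)
  moreover have "\<not> l dvd m"
    using \<open>coprime l m\<close> \<open>prime l\<close> by (metis coprime_absorb_left not_prime_unit)
  ultimately have "int_eval ((z ^ e) ^ l) F = 0"
    using int_eval_root_of_unity_prime_power[of m "z ^ e" l F] factor assms by simp
  then show ?case
    by (simp add: mult.commute flip: power_mult)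
qed (use assms in auto)

text \<open>The Galois action on cyclotomic numbers, without field extensions.\<close>

lemma int_combination_roots_of_unity_power:
  fixes c :: "'i \<Rightarrow> int"
  assumes "m > 0" "coprime e m" "e > 0"
    and z: "\<And>i. i \<in> I \<Longrightarrow> z i ^ m = 1"
    and sum0: "(\<Sum>i\<in>I. of_int (c i) * z i) = (0 :: complex)"
  shows "(\<Sum>i\<in>I. of_int (c i) * z i ^ e) = 0"
proof -
  \<comment> \<open>All \<open>z i\<close> are powers of the single root \<open>w\<close>, so the
    relation becomes one integral polynomial vanishing at \<open>w\<close>.\<close>
  define w where "w = cis (2 * pi / m)"
  have wm: "w ^ m = 1" using assms(1) by (simp add: w_def DeMoivre)
  have "\<exists>k. z i = w ^ k" if "i \<in> I" for i
  proof -
    have "z i \<in> {z. z ^ m = 1}" using z that by simp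
    then have "z i \<in> (\<lambda>k. cis (2 * pi * real k / real m)) ` {..<m}"
      using bij_betw_roots_unity[OF assms(1)] by (simp add: bij_betw_def)
    then show ?thesis by (auto simp: w_def DeMoivre mult_ac)
  qed
  then obtain k where k: "\<And>i. i \<in> I \<Longrightarrow> z i = w ^ k i" by metis
  define F where "F = (\<Sum>i\<in>I. monom (c i) (k i))"
  have "int_eval w F = 0" using sum0 by (simp add: F_def k)
  then have "int_eval (w ^ e) F = 0"
    using int_eval_root_of_unity_power assms wm by blast
  then show ?thesis
    by (simp add: F_def k mult.commute flip: power_mult)
qed


subsection \<open>Fourier inversion on cyclic groups\<close>

lemma prime_coprime_right_iff:
  fixes n :: nat
  assumes "prime n"
  shows "coprime k n \<longleftrightarrow> \<not> n dvd k"
proof -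
  have "\<not> is_unit n" using assms by (metis not_prime_unit)
  then show ?thesis
    using assms coprime_absorb_left[of n k] prime_imp_coprime[of n k]
    by (auto simp: coprime_commute)
qed

text \<open>A Bezout inverse of \<open>k\<close> modulo \<open>n\<close> would turn
  \<open>u ^ k = 1\<close> into \<open>u = 1\<close>. The monoid setting serves complex roots of
  unity and elements of the finite field alike.\<close>

lemma power_eq_1_iff_dvd_prime:
  fixes u :: "'a :: comm_monoid_mult"
  assumes "prime n" "u ^ n = 1" "u \<noteq> 1"
  shows "u ^ k = 1 \<longleftrightarrow> n dvd k"
proof
  assume "u ^ k = 1"
  show "n dvd k"
  proof (rule ccontr)
    assume "\<not> n dvd k"
    then have "coprime k n" by (simp only: prime_coprime_right_iff[OF assms(1)] simp_thms)
    have "k \<noteq> 0" using \<open>\<not> n dvd k\<close> by (metis dvd_0_right)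
    then obtain x y where "k * x = n * y + 1"
      using bezout_nat[OF \<open>k \<noteq> 0\<close>, of n] coprime_imp_gcd_eq_1[OF \<open>coprime k n\<close>] by auto
    then have "u ^ (k * x) = u ^ (n * y) * u" by (simp add: mult.commute)
    then show False
      unfolding power_mult using \<open>u ^ k = 1\<close> assms(2,3) by simp
  qed
next
  assume "n dvd k"
  then obtain c where "k = n * c" by (rule dvdE)
  then show "u ^ k = 1" by (simp only: power_mult assms(2) power_one)
qed

lemma power_cong_exponent:
  fixes u :: "'a :: comm_monoid_mult"
  assumes "u ^ n = 1" "[a = b] (mod n)"
  shows "u ^ a = u ^ b"
proof -
  have "u ^ c = u ^ (c mod n)" for c
  proof -
    have "u ^ c = u ^ (n * (c div n) + c mod n)" by simp
    also have "\<dots> = u ^ (c mod n)" unfolding power_add power_mult by (simp add: assms)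
    finally show ?thesis .
  qed
  then show ?thesis using assms(2) by (metis cong_def)
qed

lemma sum_powers_of_order:
  fixes u :: "'a :: field"
  assumes order: "\<And>k. u ^ k = 1 \<longleftrightarrow> n dvd k"
  shows "(\<Sum>k<n. u ^ (k * s)) = (if n dvd s then of_nat n else 0)"
proof -
  have "(\<Sum>k<n. u ^ (k * s)) = (\<Sum>k<n. (u ^ s) ^ k)"
    by (simp add: mult.commute flip: power_mult)
  moreover have "(u ^ s) ^ n = 1" using order[of "s * n"] by (simp add: power_mult)
  ultimately show ?thesis
    using order[of s] by (auto simp: geometric_sum)
qed

text \<open>The exponent \<open>(n - 1) * r\<close> plays the role of \<open>- r\<close> modulo \<open>n\<close>.\<close>

lemma fourier_inversion:
  fixes u :: "'a :: field"
  assumes order: "\<And>k. u ^ k = 1 \<longleftrightarrow> n dvd k" and "n > 0" "finite I"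
  shows "(\<Sum>l<n. u ^ (l * ((n - 1) * r)) * (\<Sum>i\<in>I. g i * u ^ (l * t i)))
           = of_nat n * (\<Sum>i | i \<in> I \<and> [t i = r] (mod n). g i)"
proof -
  have dvd: "n dvd (n - 1) * r + s \<longleftrightarrow> [s = r] (mod n)" for s
  proof -
    have "n dvd (n - 1) * r + s \<longleftrightarrow> [(n - 1) * r + s = 0] (mod n)"
      by (simp add: cong_0_iff)
    also have "\<dots> \<longleftrightarrow> [(n - 1) * r + s + r = 0 + r] (mod n)"
      by (simp only: cong_add_rcancel_nat)
    also have "(n - 1) * r + s + r = n * r + s"
      using \<open>n > 0\<close> by (cases n) simp_all
    finally show ?thesis by (simp add: cong_def)
  qed
  have "(\<Sum>l<n. u ^ (l * ((n - 1) * r)) * (\<Sum>i\<in>I. g i * u ^ (l * t i)))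
      = (\<Sum>l<n. \<Sum>i\<in>I. g i * u ^ (l * ((n - 1) * r + t i)))"
    by (simp add: sum_distrib_left power_add distrib_left mult_ac)
  also have "\<dots> = (\<Sum>i\<in>I. g i * (\<Sum>l<n. u ^ (l * ((n - 1) * r + t i))))"
    by (subst sum.swap) (simp add: sum_distrib_left)
  also have "\<dots> = (\<Sum>i\<in>I. if [t i = r] (mod n) then of_nat n * g i else 0)"
    unfolding sum_powers_of_order[OF order] dvd by (intro sum.cong) auto
  also have "\<dots> = of_nat n * (\<Sum>i | i \<in> I \<and> [t i = r] (mod n). g i)"
    using \<open>finite I\<close> by (simp add: sum.If_cases sum_distrib_left Int_def)
  finally show ?thesis .
qed

lemmas fourier_inversion_prime_order =
  fourier_inversion[OF power_eq_1_iff_dvd_prime prime_gt_0_nat]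

text \<open>In Fourier inversion only the term \<open>l = 0\<close> survives, and it is the total
  sum whichever residue \<open>r\<close> is chosen.\<close>

lemma sum_fibre_of_vanishing_twists:
  fixes u :: "'a :: field"
  assumes "prime n" "u ^ n = 1" "u \<noteq> 1" "finite I"
    and vanish: "\<And>l. coprime l n \<Longrightarrow> (\<Sum>i\<in>I. g i * u ^ (l * t i)) = 0"
  shows "of_nat n * (\<Sum>i | i \<in> I \<and> [t i = r] (mod n). g i) = (\<Sum>i\<in>I. g i)"
proof -
  have "n > 0" using assms(1) prime_gt_0_nat by blast
  have *: "(\<Sum>i\<in>I. g i * u ^ (l * t i)) = 0" if "l < n" "l \<noteq> 0" for l
  proof (rule vanish)
    have "\<not> n dvd l" using that by (auto dest: dvd_imp_le)
    then show "coprime l n"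
      using prime_coprime_right_iff[OF assms(1)] by simp
  qed
  have "of_nat n * (\<Sum>i | i \<in> I \<and> [t i = r] (mod n). g i)
      = (\<Sum>l<n. u ^ (l * ((n - 1) * r)) * (\<Sum>i\<in>I. g i * u ^ (l * t i)))"
    using fourier_inversion_prime_order[OF assms(1-3) assms(1,4)] by metis
  also have "\<dots> = (\<Sum>l\<in>{0}. u ^ (l * ((n - 1) * r)) * (\<Sum>i\<in>I. g i * u ^ (l * t i)))"
    using \<open>n > 0\<close> * by (intro sum.mono_neutral_right) auto
  finally show ?thesis by simp
qed

subsection \<open>Twisted sums of roots of unity\<close>

text \<open>By the Chinese remainder theorem a single exponent acts as \<open>k\<close> on
  \<open>n\<close>-th roots and as \<open>l\<close> on \<open>p\<close>-th roots: the two Galois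
  actions are independent.\<close>

lemma int_combination_roots_of_unity_powers:
  fixes c :: "'i \<Rightarrow> int" and x y :: "'i \<Rightarrow> complex"
  assumes "coprime n p" "n > 0" "p > 0" "coprime k n" "coprime l p"
    and x: "\<And>i. i \<in> I \<Longrightarrow> x i ^ n = 1" and y: "\<And>i. i \<in> I \<Longrightarrow> y i ^ p = 1"
    and sum0: "(\<Sum>i\<in>I. of_int (c i) * (x i * y i)) = 0"
  shows "(\<Sum>i\<in>I. of_int (c i) * (x i ^ k * y i ^ l)) = 0"
proof -
  obtain e0 where e0: "[e0 = k] (mod n)" "[e0 = l] (mod p)"
    using binary_chinese_remainder_nat[OF assms(1)] by blast
  \<comment> \<open>Adding \<open>n * p\<close> keeps both residues and makes the exponent
    positive.\<close>
  define e where "e = e0 + n * p"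
  have e: "[e = k] (mod n)" "[e = l] (mod p)" "e > 0"
    using e0 assms by (auto simp: e_def cong_def)
  have "coprime e n" "coprime e p"
    using e assms by (metis cong_imp_coprime cong_sym coprime_commute)+
  then have "(\<Sum>i\<in>I. of_int (c i) * (x i * y i) ^ e) = 0"
  proof (intro int_combination_roots_of_unity_power[where m = "n * p"])
    show "(x i * y i) ^ (n * p) = 1" if "i \<in> I" for i
      using x[OF that] y[OF that] by (metis power_mult mult.commute power_mult_distrib power_one mult_1)
  qed (use assms e in auto)
  moreover have "(x i * y i) ^ e = x i ^ k * y i ^ l" if "i \<in> I" for i
    using power_cong_exponent[OF x[OF that] e(1)] power_cong_exponent[OF y[OF that] e(2)]
    by (simp add: power_mult_distrib)
  ultimately show ?thesis by simp
qed

lemma root_of_unity_sums_eq_powers: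
  fixes x x' y :: "'i \<Rightarrow> complex"
  assumes "coprime n p" "n > 0" "p > 0" "coprime k n" "coprime l p"
    and x: "\<And>i. i \<in> I \<Longrightarrow> x i ^ n = 1" and x': "\<And>i. i \<in> I \<Longrightarrow> x' i ^ n = 1"
    and y: "\<And>i. i \<in> I \<Longrightarrow> y i ^ p = 1"
    and eq: "(\<Sum>i\<in>I. x i * y i) = (\<Sum>i\<in>I. x' i * y i)"
  shows "(\<Sum>i\<in>I. x i ^ k * y i ^ l) = (\<Sum>i\<in>I. x' i ^ k * y i ^ l)"
proof -
  \<comment> \<open>The Boolean marks the side of the equation, and the sign \<open>c\<close> turns
    the equation into one vanishing integer combination.\<close>
  define J where "J = I \<times> (UNIV :: bool set)"
  define c :: "'i \<times> bool \<Rightarrow> int" where "c = (\<lambda>(i, b). if b then 1 else - 1)"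
  define X where "X = (\<lambda>(i, b). if b then x i else x' i)"
  define Y where "Y = (\<lambda>(i, b :: bool). y i)"
  have split: "(\<Sum>j\<in>J. of_int (c j) * (X j ^ a * Y j ^ b))
      = (\<Sum>i\<in>I. x i ^ a * y i ^ b) - (\<Sum>i\<in>I. x' i ^ a * y i ^ b)" for a b
    unfolding J_def sum.cartesian_product'
    by (simp add: c_def X_def Y_def UNIV_bool sum_subtractf sum_negf algebra_simps sum.distrib)
  have "(\<Sum>j\<in>J. of_int (c j) * (X j * Y j)) = 0"
    using split[of 1 1] eq by simp
  then have "(\<Sum>j\<in>J. of_int (c j) * (X j ^ k * Y j ^ l)) = 0"
    using assms by (intro int_combination_roots_of_unity_powers[of n p])
      (auto simp: J_def X_def Y_def split: if_splits)
  then show ?thesis unfolding split by simp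
qed

text \<open>Conjugation makes all twists of the relation vanish, and each fibre of \<open>s\<close>
  modulo \<open>n\<close> is a single coefficient. Up to a factor,
  \<open>1 + X + ... + X ^ (n - 1)\<close> is thus the only relation of degree below
  \<open>n\<close>.\<close>

lemma int_combination_prime_roots_constant:
  fixes c :: "nat \<Rightarrow> int" and \<omega> :: complex
  assumes "prime n" "\<omega> ^ n = 1" "\<omega> \<noteq> 1" and sum0: "(\<Sum>s<n. of_int (c s) * \<omega> ^ s) = 0"
    and "a < n" "b < n"
  shows "c a = c b"
proof -
  have "n > 0" using assms(1) prime_gt_0_nat by blast
  have root: "(\<omega> ^ s) ^ n = 1" for s
    using assms(2) by (metis mult.commute power_mult power_one)
  have "of_nat n * of_int (c r) = (\<Sum>s<n. of_int (c s) :: complex)" if "r < n" for r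
  proof -
    have "(\<Sum>s<n. of_int (c s) * \<omega> ^ (l * s)) = 0" if "coprime l n" for l
    proof -
      have "(\<Sum>s<n. of_int (c s) * ((\<omega> ^ s) ^ l * 1 ^ 1)) = 0"
        using that sum0 root \<open>n > 0\<close>
        by (intro int_combination_roots_of_unity_powers[of n 1]) auto
      then show ?thesis by (simp add: mult.commute flip: power_mult)
    qed
    then have "of_nat n * (\<Sum>s | s \<in> {..<n} \<and> [s = r] (mod n). of_int (c s))
        = (\<Sum>s<n. of_int (c s) :: complex)"
      by (intro sum_fibre_of_vanishing_twists[OF assms(1-3)]) auto
    moreover have "{s. s \<in> {..<n} \<and> [s = r] (mod n)} = {r}"
      using that by (auto simp: cong_def)
    ultimately show ?thesis by simp
  qed
  from this[OF \<open>a < n\<close>] this[OF \<open>b < n\<close>]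
  have "of_nat n * of_int (c a) = (of_nat n * of_int (c b) :: complex)" by simp
  then show ?thesis using \<open>n > 0\<close> by simp
qed

text \<open>If the sum vanished, conjugating \<zeta> alone would give every fibre of
  \<open>t\<close> the same share of the sum of all \<open>\<omega> ^ s\<close>. For
  \<open>\<omega> = 1\<close> this makes \<open>p\<close> divide \<open>n\<close>; otherwise every
  share is zero, which is impossible for a fibre that is neither empty nor everything.\<close>

lemma twisted_sum_nonzero:
  fixes \<omega> \<zeta> :: complex and t :: "nat \<Rightarrow> nat"
  assumes n: "prime n" "\<omega> ^ n = 1" and p: "prime p" "\<zeta> ^ p = 1" "\<zeta> \<noteq> 1" and "n \<noteq> p"
    and t: "\<And>s. t s < p" and nonconst: "\<exists>s<n. t s \<noteq> t 0"
  shows "(\<Sum>s<n. \<omega> ^ s * \<zeta> ^ t s) \<noteq> 0"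
proof
  assume zero: "(\<Sum>s<n. \<omega> ^ s * \<zeta> ^ t s) = 0"
  have pos: "n > 0" "p > 0" and cop: "coprime n p"
    using n p \<open>n \<noteq> p\<close> by (auto simp: prime_gt_0_nat primes_coprime)
  have roots: "(\<omega> ^ s) ^ n = 1" "(\<zeta> ^ s) ^ p = 1" for s
    using n p by (metis mult.commute power_mult power_one)+
  have fibre: "of_nat p * (\<Sum>s | s \<in> {..<n} \<and> t s = r. \<omega> ^ s) = (\<Sum>s<n. \<omega> ^ s)" if "r < p" for r
  proof -
    have "(\<Sum>s<n. \<omega> ^ s * \<zeta> ^ (l * t s)) = 0" if "coprime l p" for l
    proof -
      have "(\<Sum>s<n. of_int 1 * ((\<omega> ^ s) ^ 1 * (\<zeta> ^ t s) ^ l)) = 0"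
        by (rule int_combination_roots_of_unity_powers[of n p])
          (use pos cop roots zero that in auto)
      then show ?thesis by (simp add: mult.commute flip: power_mult)
    qed
    then have "of_nat p * (\<Sum>s | s \<in> {..<n} \<and> [t s = r] (mod p). \<omega> ^ s) = (\<Sum>s<n. \<omega> ^ s)"
      by (intro sum_fibre_of_vanishing_twists[OF p]) auto
    moreover have "[t s = r] (mod p) \<longleftrightarrow> t s = r" for s
      using t that by (simp add: cong_def)
    ultimately show ?thesis by simp
  qed
  show False
  proof (cases "\<omega> = 1")
    case True
    have "of_nat p * of_nat (card {s \<in> {..<n}. t s = 0}) = (of_nat n :: complex)"
      using fibre[OF pos(2)] by (simp add: True)
    then have "p * card {s \<in> {..<n}. t s = 0} = n"
      by (metis of_nat_eq_iff of_nat_mult)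
    then have "p dvd n" by (metis dvd_triv_left)
    then show False using n p \<open>n \<noteq> p\<close> primes_dvd_imp_eq by blast
  next
    case False
    have "(\<Sum>s<n. \<omega> ^ s) = 0" using n False by (simp add: geometric_sum)
    then have "(\<Sum>s | s \<in> {..<n} \<and> t s = t 0. \<omega> ^ s) = 0"
      using fibre[of "t 0"] t pos by simp
    \<comment> \<open>The indicator of the fibre of \<open>t 0\<close> must have constant
      coefficients, so \<open>t\<close> would be constant.\<close>
    then have "(\<Sum>s<n. of_int (if t s = t 0 then 1 else 0) * \<omega> ^ s) = 0"
      by (simp add: if_distrib if_distribR sum.If_cases Int_def cong: if_cong)
    from int_combination_prime_roots_constant[OF n False this, of _ 0] pos nonconst
    show False by fastforce
  qed
qed

text \<open>With the conjugation by \<open>k\<close> on \<open>n\<close>-th roots fixed,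
  \<open>l\<close> runs over the conjugates of \<zeta>; Fourier inversion in \<open>l\<close>
  separates the values of \<open>t\<close>.\<close>

lemma sum_fibres_eq_of_twisted_sums_eq:
  fixes \<omega> \<omega>' \<zeta> :: complex and t :: "nat \<Rightarrow> nat"
  assumes n: "prime n" "\<omega> ^ n = 1" "\<omega>' ^ n = 1"
    and p: "prime p" "\<zeta> ^ p = 1" "\<zeta> \<noteq> 1" and "n \<noteq> p"
    and t: "\<And>s. t s < p"
    and eq: "(\<Sum>s<n. \<omega> ^ s * \<zeta> ^ t s) = (\<Sum>s<n. \<omega>' ^ s * \<zeta> ^ t s)"
    and k: "coprime k n" and "r < p"
  shows "of_nat p * ((\<Sum>s | s \<in> {..<n} \<and> t s = r. \<omega> ^ (k * s))
      - (\<Sum>s | s \<in> {..<n} \<and> t s = r. \<omega>' ^ (k * s)))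
    = (\<Sum>s<n. \<omega> ^ (k * s)) - (\<Sum>s<n. \<omega>' ^ (k * s))"
proof -
  have pos: "n > 0" "p > 0" and cop: "coprime n p"
    using n p \<open>n \<noteq> p\<close> by (auto simp: prime_gt_0_nat primes_coprime)
  have roots: "(\<omega> ^ s) ^ n = 1" "(\<omega>' ^ s) ^ n = 1" "(\<zeta> ^ s) ^ p = 1" for s
    using n p by (metis mult.commute power_mult power_one)+
  have "(\<Sum>s<n. (\<omega> ^ (k * s) - \<omega>' ^ (k * s)) * \<zeta> ^ (l * t s)) = 0" if "coprime l p" for l
  proof -
    have "(\<Sum>s<n. (\<omega> ^ s) ^ k * (\<zeta> ^ t s) ^ l) = (\<Sum>s<n. (\<omega>' ^ s) ^ k * (\<zeta> ^ t s) ^ l)"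
      by (rule root_of_unity_sums_eq_powers[of n p]) (use pos cop roots eq that k in auto)
    then show ?thesis
      by (simp add: left_diff_distrib right_diff_distrib sum_subtractf mult.commute flip: power_mult)
  qed
  then have "of_nat p * (\<Sum>s | s \<in> {..<n} \<and> [t s = r] (mod p). \<omega> ^ (k * s) - \<omega>' ^ (k * s))
      = (\<Sum>s<n. \<omega> ^ (k * s) - \<omega>' ^ (k * s))"
    by (intro sum_fibre_of_vanishing_twists[OF p]) auto
  moreover have "[t s = r] (mod p) \<longleftrightarrow> t s = r" for s
    using t \<open>r < p\<close> by (simp add: cong_def)
  ultimately show ?thesis by (simp add: sum_subtractf)
qed

text \<open>Otherwise the fibre of \<open>t 0\<close> yields an integral relation between powers of
  \<omega>', and equality of its coefficients at \<open>0\<close> and \<open>1\<close> forces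
  \<open>p\<close> to divide \<open>n\<close>.\<close>

lemma twisted_sums_eq_imp_nontrivial:
  fixes \<omega>' \<zeta> :: complex and t :: "nat \<Rightarrow> nat"
  assumes n: "prime n" "\<omega>' ^ n = 1"
    and p: "prime p" "\<zeta> ^ p = 1" "\<zeta> \<noteq> 1" and "n \<noteq> p"
    and t: "\<And>s. t s < p"
    and eq: "(\<Sum>s<n. \<zeta> ^ t s) = (\<Sum>s<n. \<omega>' ^ s * \<zeta> ^ t s)"
  shows "\<omega>' = 1"
proof (rule ccontr)
  assume ne: "\<omega>' \<noteq> 1"
  define T where "T = {s. s \<in> {..<n} \<and> t s = t 0}"
  have "n > 1" using n prime_gt_1_nat by blast
  have "(\<Sum>s<n. \<omega>' ^ s) = 0" using n ne by (simp add: geometric_sum)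
  then have "of_nat p * (of_nat (card T) - (\<Sum>s\<in>T. \<omega>' ^ s)) = (of_nat n :: complex)"
    using sum_fibres_eq_of_twisted_sums_eq[of n 1 \<omega>' p \<zeta> t 1 "t 0"] assms
    by (simp add: T_def)
  \<comment> \<open>The coefficients of
    \<open>p * (\<Sum>s\<in>T. \<omega>' ^ s) + n - p * card T = 0\<close>, with the constant placed
    at \<open>s = 0\<close>.\<close>
  define c where "c = (\<lambda>s. (if s \<in> T then int p else 0)
    + (if s = 0 then int n - int p * int (card T) else 0))"
  have "(\<Sum>s<n. of_int (c s) * \<omega>' ^ s)
      = (\<Sum>s<n. if s \<in> T then of_nat p * \<omega>' ^ s else 0)
        + (\<Sum>s<n. if s = 0 then of_nat n - of_nat p * of_nat (card T) else 0)"
    unfolding sum.distrib[symmetric] by (intro sum.cong) (auto simp: c_def algebra_simps)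
  also have "(\<Sum>s<n. if s \<in> T then of_nat p * \<omega>' ^ s else 0) = of_nat p * (\<Sum>s\<in>T. \<omega>' ^ s)"
  proof -
    have "T = {..<n} \<inter> T" by (auto simp: T_def)
    then show ?thesis by (simp add: sum_distrib_left flip: sum.inter_restrict)
  qed
  also have "(\<Sum>s<n. if s = 0 then of_nat n - of_nat p * of_nat (card T) else 0)
      = of_nat n - of_nat p * of_nat (card T)"
    using \<open>n > 1\<close> by simp
  also have "of_nat p * (\<Sum>s\<in>T. \<omega>' ^ s) + (of_nat n - of_nat p * of_nat (card T)) = 0"
    using \<open>of_nat p * (of_nat (card T) - (\<Sum>s\<in>T. \<omega>' ^ s)) = (of_nat n :: complex)\<close>
    by (simp add: algebra_simps)
  finally have "c 0 = c 1"
    using int_combination_prime_roots_constant[OF n ne, of c 0 1] \<open>n > 1\<close> by simp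
  moreover have "0 \<in> T" using \<open>n > 1\<close> by (simp add: T_def)
  ultimately have "int n = int p * (int (card T) - 1 + (if 1 \<in> T then 1 else 0))"
    by (auto simp: c_def algebra_simps split: if_splits)
  then have "p dvd n" by (metis dvd_triv_left int_dvd_int_iff)
  then show False using n p \<open>n \<noteq> p\<close> primes_dvd_imp_eq by blast
qed

text \<open>For each fibre \<open>T\<close> of \<open>t\<close> the power sums over \<open>T\<close>
  and over \<open>j * T\<close> agree. Fourier inversion recovers the residues in each, so
  multiplication by \<open>j\<close> preserves \<open>T\<close> modulo \<open>n\<close>.\<close>

lemma twisted_sums_eq_imp_invariant:
  fixes \<omega> \<zeta> :: complex and t :: "nat \<Rightarrow> nat"
  assumes n: "prime n" "\<omega> ^ n = 1" "\<omega> \<noteq> 1" and j: "coprime j n"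
    and p: "prime p" "\<zeta> ^ p = 1" "\<zeta> \<noteq> 1" and "n \<noteq> p"
    and t: "\<And>s. t s < p" and per: "\<And>s s'. [s = s'] (mod n) \<Longrightarrow> t s = t s'"
    and eq: "(\<Sum>s<n. \<omega> ^ s * \<zeta> ^ t s) = (\<Sum>s<n. (\<omega> ^ j) ^ s * \<zeta> ^ t s)"
  shows "t (j * s) = t s"
proof -
  have pos: "n > 0" "p > 0" using n p by (auto simp: prime_gt_0_nat)
  define s0 where "s0 = s mod n"
  define T where "T = {s. s \<in> {..<n} \<and> t s = t s0}"
  have "finite T" by (simp add: T_def)
  have root: "(\<omega> ^ i) ^ n = 1" for i
    using n by (metis mult.commute power_mult power_one)
  have ne: "\<omega> ^ j \<noteq> 1"
    using power_eq_1_iff_dvd_prime[OF n] j prime_coprime_right_iff[OF n(1)] by blast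
  have T_eq: "(\<Sum>s\<in>T. \<omega> ^ (k * s)) = (\<Sum>s\<in>T. \<omega> ^ (k * (j * s)))" for k
  proof (cases "coprime k n")
    case True
    then have "\<not> n dvd k" using prime_coprime_right_iff[OF n(1)] by blast
    moreover have "\<omega> ^ k \<noteq> 1" "(\<omega> ^ j) ^ k \<noteq> 1"
      using calculation power_eq_1_iff_dvd_prime[OF n] power_eq_1_iff_dvd_prime[OF n(1) root ne] by auto
    then have "(\<Sum>s<n. \<omega> ^ (k * s)) = 0" "(\<Sum>s<n. (\<omega> ^ j) ^ (k * s)) = 0"
      using root[of k] root[of "j * k"]
      by (simp_all add: power_mult geometric_sum)
    then show ?thesis
      using sum_fibres_eq_of_twisted_sums_eq[OF n(1,2) root p \<open>n \<noteq> p\<close> t eq True, of "t s0"] t pos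
      by (simp add: T_def mult_ac flip: power_mult)
  next
    case False
    then have "n dvd k" using prime_coprime_right_iff[OF n(1)] by blast
    then have "\<omega> ^ (k * i) = 1" for i
      using power_eq_1_iff_dvd_prime[OF n] by simp
    then show ?thesis by simp
  qed
  \<comment> \<open>The multiplicity of the residue \<open>j * s0\<close> in \<open>T\<close> and in
    \<open>j * T\<close>; the second is positive because of \<open>s0\<close> itself.\<close>
  have "of_nat n * (\<Sum>i | i \<in> T \<and> [i = j * s0] (mod n). 1)
      = (of_nat n * (\<Sum>i | i \<in> T \<and> [j * i = j * s0] (mod n). 1) :: complex)"
    using fourier_inversion_prime_order[OF n n(1) \<open>finite T\<close>, of "j * s0" "\<lambda>_. 1" "\<lambda>s. s"]
      fourier_inversion_prime_order[OF n n(1) \<open>finite T\<close>, of "j * s0" "\<lambda>_. 1" "\<lambda>s. j * s"] T_eq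
    by simp
  then have "card {i. i \<in> T \<and> [i = j * s0] (mod n)} = card {i. i \<in> T \<and> [j * i = j * s0] (mod n)}"
    using pos by simp
  moreover have "s0 \<in> {i. i \<in> T \<and> [j * i = j * s0] (mod n)}"
    using pos by (simp add: T_def s0_def)
  then have "card {i. i \<in> T \<and> [j * i = j * s0] (mod n)} > 0"
    using \<open>finite T\<close> by (auto simp only: card_gt_0_iff finite_Collect_conjI Collect_mem_eq)
  ultimately have "card {i. i \<in> T \<and> [i = j * s0] (mod n)} > 0" by simp
  then have "{i. i \<in> T \<and> [i = j * s0] (mod n)} \<noteq> {}" by (metis card.empty less_irrefl)
  then obtain i where "i \<in> T" "[i = j * s0] (mod n)" by blast
  then have "t (j * s0) = t s0" using per[of i "j * s0"] by (simp add: T_def)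
  moreover have "[s0 = s] (mod n)" by (simp add: s0_def cong_def)
  ultimately show ?thesis
    using per by (metis cong_scalar_left)
qed

section \<open>Exponents in groups of prime order\<close>

lemma root_of_unity_power_of_prime_order:
  fixes \<omega> \<omega>' :: complex
  assumes n: "prime n" "\<omega> ^ n = 1" "\<omega> \<noteq> 1" and "\<omega>' ^ n = 1"
  obtains j where "\<omega>' = \<omega> ^ j"
proof -
  have "n > 0" using n prime_gt_0_nat by blast
  have root: "(\<omega> ^ i) ^ n = 1" for i
    using n by (metis mult.commute power_mult power_one)
  have inj: "inj_on (\<lambda>i. \<omega> ^ i) {..<n}"
  proof (rule linorder_inj_onI)
    fix a b assume ab: "a < b" "a \<in> {..<n}" "b \<in> {..<n}"
    then have "\<omega> ^ b = \<omega> ^ a * \<omega> ^ (b - a)" by (simp flip: power_add)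
    moreover have "\<omega> ^ (b - a) \<noteq> 1"
      using power_eq_1_iff_dvd_prime[OF n, of "b - a"] ab by (auto dest: dvd_imp_le)
    moreover have "\<omega> \<noteq> 0" using n \<open>n > 0\<close> by (auto simp: power_0_left)
    ultimately show "\<omega> ^ a \<noteq> \<omega> ^ b" by simp
  qed auto
  have "(\<lambda>i. \<omega> ^ i) ` {..<n} = {z. z ^ n = 1}"
  proof (rule card_subset_eq)
    show "card ((\<lambda>i. \<omega> ^ i) ` {..<n}) = card {z :: complex. z ^ n = 1}"
      using card_roots_unity_eq[OF \<open>n > 0\<close>] card_image[OF inj] by simp
  qed (use \<open>n > 0\<close> root finite_roots_unity[of n] in auto)
  then show thesis using assms that by auto
qed

text \<open>Both sides are sums of characters of the group generated by \<open>u\<close>, with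
  values in the field itself. On the right the exponent \<open>j\<close> occurs only for
  \<open>i = 0\<close>, since \<open>p ^ i < n\<close>; independence of characters makes it occur on
  the left.\<close>

lemma frobenius_exponent_of_power_sums_eq:
  fixes u :: "'a :: field"
  assumes n: "prime n" "u ^ n = 1" "u \<noteq> 1" and "of_nat n \<noteq> (0 :: 'a)"
    and p: "p > 1" and less: "\<And>i. i < f \<Longrightarrow> p ^ i < n" and "f > 0" and j: "coprime j n"
    and eq: "\<And>s. (\<Sum>i<f. u ^ (s * p ^ i)) = (\<Sum>i<f. u ^ (j * s * p ^ i))"
  obtains i where "i < f" "[p ^ i = j] (mod n)"
proof -
  have "{i. i \<in> {..<f} \<and> [j * p ^ i = j] (mod n)} = {0}"
  proof -
    have "i = 0" if "i < f" "[j * p ^ i = j] (mod n)" for i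
    proof -
      have "[p ^ i = 1] (mod n)"
        using cong_mult_lcancel_nat[OF j, of "p ^ i" 1] that by simp
      then show ?thesis
        using less[OF that(1)] less[OF \<open>f > 0\<close>] p by (simp add: cong_def)
    qed
    then show ?thesis using \<open>f > 0\<close> by auto
  qed
  then have "of_nat n * (\<Sum>i | i \<in> {..<f} \<and> [p ^ i = j] (mod n). 1) = (of_nat n :: 'a)"
    using fourier_inversion_prime_order[OF n n(1), of "{..<f}" j "\<lambda>_. 1" "\<lambda>i. p ^ i"]
      fourier_inversion_prime_order[OF n n(1), of "{..<f}" j "\<lambda>_. 1" "\<lambda>i. j * p ^ i"] eq
    by (simp add: mult_ac)
  then have "{i. i \<in> {..<f} \<and> [p ^ i = j] (mod n)} \<noteq> {}"
    using \<open>of_nat n \<noteq> 0\<close> by (metis mult_zero_right sum.empty)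
  then show thesis using that by auto
qed

text \<open>Fourier inversion at the exponent \<open>1\<close> gives \<open>n\<close>, as only
  \<open>i = 0\<close> contributes, but it would give zero for a function constant in
  \<open>s\<close>. Hence the trace is not constant on the kernel of the norm.\<close>

lemma power_sums_nonconstant:
  fixes u :: "'a :: field"
  assumes n: "prime n" "u ^ n = 1" "u \<noteq> 1" and "of_nat n \<noteq> (0 :: 'a)"
    and p: "p > 1" and less: "\<And>i. i < f \<Longrightarrow> p ^ i < n" and "f > 0"
  obtains s where "s < n" "(\<Sum>i<f. u ^ (s * p ^ i)) \<noteq> (\<Sum>i<f. u ^ (0 * p ^ i))"
proof (rule ccontr)
  assume "\<not> thesis"
  with that have const: "(\<Sum>i<f. u ^ (s * p ^ i)) = (\<Sum>i<f. u ^ (0 * p ^ i))" if "s < n" for s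
    using \<open>s < n\<close> by blast
  have "\<not> n dvd n - 1"
    using prime_gt_1_nat[OF n(1)] by (auto dest: dvd_imp_le)
  have "{i. i \<in> {..<f} \<and> [p ^ i = 1] (mod n)} = {0}"
    using less less[OF \<open>f > 0\<close>] p \<open>f > 0\<close> by (auto simp: cong_def)
  then have "of_nat n = (\<Sum>l<n. u ^ (l * ((n - 1) * 1)) * (\<Sum>i<f. 1 * u ^ (l * p ^ i)))"
    using fourier_inversion_prime_order[OF n n(1), of "{..<f}" 1 "\<lambda>_. 1" "\<lambda>i. p ^ i"] by simp
  also have "\<dots> = (\<Sum>l<n. u ^ (l * (n - 1)) * (\<Sum>i<f. u ^ (0 * p ^ i)))"
    using const by (intro sum.cong) auto
  also have "\<dots> = 0"
    using sum_powers_of_order[OF power_eq_1_iff_dvd_prime[OF n], of "n - 1"] \<open>\<not> n dvd n - 1\<close>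
    by (simp flip: sum_distrib_right)
  finally show False using \<open>of_nat n \<noteq> 0\<close> by simp
qed


subsection \<open>Finite fields\<close>

lemma CHAR_finite_field:
  assumes "prime p" "CARD('a::{field, finite}) = p ^ f"
  shows "CHAR('a) = p"
proof -
  have pos: "CHAR('a) > 0" by (rule finite_imp_CHAR_pos) simp
  then have "prime CHAR('a)" by (rule prime_CHAR_semidom)
  moreover have "CHAR('a) dvd p ^ f" using CHAR_dvd_CARD[where 'a = 'a] assms(2) by simp
  ultimately show ?thesis using assms(1) by (metis prime_dvd_power primes_dvd_imp_eq)
qed

lemma finite_field_generator:
  obtains g :: "'a::{field, finite}"
  where "g \<noteq> 0" "g ^ (CARD('a) - 1) = 1" "inj_on (\<lambda>i. g ^ i) {..<CARD('a) - 1}"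
    "\<And>x. x \<noteq> 0 \<Longrightarrow> \<exists>i<CARD('a) - 1. x = g ^ i"
proof -
  \<comment> \<open>The type is repackaged as a ring record to apply the cyclicity of its unit
    group.\<close>
  define R :: "'a ring" where
    "R = \<lparr>carrier = UNIV, mult = (*), one = 1, zero = 0, add = (+)\<rparr>"
  have R_simps: "carrier R = UNIV" "zero R = 0" "one R = 1" "mult R = (*)"
    by (simp_all add: R_def)
  interpret R: field R
  proof -
    have "\<exists>y. x + y = 0" for x :: 'a by (rule exI[of _ "- x"]) simp
    moreover have "x \<noteq> 0 \<Longrightarrow> \<exists>y. x * y = 1" for x :: 'a
      by (rule exI[of _ "inverse x"]) auto
    ultimately show "field R"
      unfolding R_def using add.right_inverse
      by unfold_locales (auto simp: algebra_simps Units_def)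
  qed
  have pow: "x [^]\<^bsub>R\<^esub> i = x ^ i" for x :: 'a and i :: nat
    by (induction i) (simp_all add: R_simps nat_pow_def mult.commute)
  have "\<exists>g\<in>carrier (mult_of R). carrier (mult_of R) = {g [^]\<^bsub>R\<^esub> i | i::nat. i \<in> UNIV}"
    by (rule R.finite_field_mult_group_has_gen) (simp add: R_simps)
  then obtain g :: 'a where g: "g \<noteq> 0" "UNIV - {0} = range (\<lambda>i::nat. g ^ i)"
    by (auto simp: R_simps pow full_SetCompr_eq)
  have card: "card (range (\<lambda>i::nat. g ^ i)) = CARD('a) - 1"
    unfolding g(2)[symmetric] by (simp add: card_Diff_singleton)
  have "\<not> inj (\<lambda>i::nat. g ^ i)"
    using finite_imageD[of "\<lambda>i::nat. g ^ i" UNIV] by auto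
  then obtain a b :: nat where ab: "a < b" "g ^ a = g ^ b"
    by (metis linorder_injI)
  have "g ^ b = g ^ a * g ^ (b - a)" using ab(1) by (simp flip: power_add)
  then have "g ^ (b - a) = 1" using ab g(1) by simp
  then have ex: "\<exists>d>0. g ^ d = 1" using ab(1) by (intro exI[of _ "b - a"]) simp
  \<comment> \<open>The order of \<open>g\<close>: its \<open>d\<close> distinct powers exhaust the
    nonzero elements, whence \<open>d = CARD('a) - 1\<close>.\<close>
  define d where "d = (LEAST d. d > 0 \<and> g ^ d = 1)"
  have d: "d > 0" "g ^ d = 1"
    using LeastI_ex[OF ex] by (simp_all add: d_def)
  have min: "\<not> (0 < e \<and> g ^ e = 1)" if "e < d" for e
    using not_less_Least that unfolding d_def by blast
  have inj: "inj_on (\<lambda>i. g ^ i) {..<d}"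
  proof (rule linorder_inj_onI)
    fix a b assume ab: "a < b" "a \<in> {..<d}" "b \<in> {..<d}"
    then have "g ^ b = g ^ a * g ^ (b - a)" by (simp flip: power_add)
    moreover have "g ^ (b - a) \<noteq> 1" using min[of "b - a"] ab by auto
    ultimately show "g ^ a \<noteq> g ^ b" using g(1) by simp
  qed auto
  have range: "range (\<lambda>i::nat. g ^ i) = (\<lambda>i. g ^ i) ` {..<d}"
  proof
    show "range (\<lambda>i::nat. g ^ i) \<subseteq> (\<lambda>i. g ^ i) ` {..<d}"
    proof
      fix x assume "x \<in> range (\<lambda>i::nat. g ^ i)"
      then obtain i :: nat where "x = g ^ i" by blast
      also have "\<dots> = g ^ (i mod d)"
        by (rule power_cong_exponent[OF d(2)]) (simp add: cong_def)
      finally show "x \<in> (\<lambda>i. g ^ i) ` {..<d}" using d(1) by simp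
    qed
  qed auto
  have "d = CARD('a) - 1" using card card_image[OF inj] range by simp
  show thesis
  proof
    show "\<exists>i<CARD('a) - 1. x = g ^ i" if "x \<noteq> 0" for x
    proof -
      have "x \<in> (\<lambda>i. g ^ i) ` {..<d}" using that g(2) range by blast
      then show ?thesis using \<open>d = CARD('a) - 1\<close> by auto
    qed
  qed (use g d inj \<open>d = CARD('a) - 1\<close> in simp_all)
qed

lemma finite_field_power_card:
  fixes x :: "'a::{field, finite}"
  shows "x ^ CARD('a) = x"
proof (cases "x = 0")
  case True
  then show ?thesis by (simp add: power_0_left)
next
  case False
  obtain g :: 'a where "g \<noteq> 0" and g: "g ^ (CARD('a) - 1) = 1"
    and "inj_on (\<lambda>i. g ^ i) {..<CARD('a) - 1}"
    and ex: "\<And>x. x \<noteq> 0 \<Longrightarrow> \<exists>i<CARD('a) - 1. x = g ^ i"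
    by (rule finite_field_generator[where 'a = 'a]) (rule that)
  obtain i where "x = g ^ i" using ex[OF False] by blast
  then have "x ^ (CARD('a) - 1) = 1" using g by (metis mult.commute power_mult power_one)
  moreover have "x ^ CARD('a) = x ^ (CARD('a) - 1) * x"
    by (metis power_minus_mult zero_less_card_finite)
  ultimately show ?thesis by simp
qed

text \<open>Factors \<open>p\<close> of \<open>k\<close> are removed by injectivity of the
  \<open>p\<close>-th power. If \<open>k > 1\<close> is prime to \<open>p\<close>, then
  \<open>(1 + X) ^ k - X ^ k - 1\<close> has the nonzero linear coefficient \<open>k\<close>, yet
  vanishes on the whole field although its degree is at most \<open>k < CARD('a)\<close>.\<close>

lemma additive_power_exponent:
  assumes "prime p" "CARD('a::{field, finite}) = p ^ f"
    and "0 < k" "k < CARD('a)" "\<And>x y :: 'a. (x + y) ^ k = x ^ k + y ^ k"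
  shows "\<exists>i. k = p ^ i"
  using assms(3-5)
proof (induction k rule: less_induct)
  case (less k)
  have char: "CHAR('a) = p" using assms(1,2) by (rule CHAR_finite_field)
  show ?case
  proof (cases "p dvd k")
    case True
    then obtain k' where k': "k = k' * p" by (metis dvd_def mult.commute)
    have "k' < k" "0 < k'" using k' less.prems prime_gt_1_nat[OF assms(1)] by auto
    moreover have "(x + y) ^ k' = x ^ k' + y ^ k'" for x y :: 'a
    proof -
      have dream: "(a + b) ^ p = a ^ p + b ^ p" for a b :: 'a
        using assms(1) by (intro freshmans_dream) (simp_all add: char)
      define D E where "D = (x + y) ^ k'" and "E = x ^ k' + y ^ k'"
      have "D ^ p = E ^ p"
        using less.prems(3)[of x y] by (simp add: D_def E_def dream k' power_mult)
      moreover have "(D - E) ^ p + E ^ p = D ^ p"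
        using dream[of "D - E" E] by simp
      ultimately have "(D - E) ^ p = 0" by simp
      then have "D - E = 0" by (metis power_not_zero)
      then show ?thesis by (simp add: D_def E_def)
    qed
    ultimately obtain i where "k' = p ^ i"
      using less.IH[of k'] less.prems by auto
    then have "k = p ^ Suc i" by (simp add: k')
    then show ?thesis by blast
  next
    case False
    have "k = 1"
    proof (rule ccontr)
      assume "k \<noteq> 1"
      with less.prems have "k > 1" by simp
      define P :: "'a poly" where "P = [:1, 1:] ^ k - (monom 1 k + 1)"
      have "coeff ([:1, 1:] ^ k :: 'a poly) 1 = of_nat k"
        using \<open>k > 1\<close> by (simp add: coeff_linear_poly_power)
      then have "coeff P 1 = of_nat k" using \<open>k > 1\<close> by (simp add: P_def)
      also have "\<dots> \<noteq> 0" using False by (simp add: of_nat_eq_0_iff_char_dvd char)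
      finally have "P \<noteq> 0" by auto
      have "degree P \<le> k"
        unfolding P_def
        by (intro degree_diff_le degree_add_le degree_monom_le)
          (simp_all add: degree_linear_power)
      moreover have "poly P x = 0" for x
        using less.prems(3)[of 1 x] by (simp add: P_def poly_monom add.commute)
      then have "card {x. poly P x = 0} = CARD('a)" by simp
      ultimately show False
        using card_poly_roots_bound[OF \<open>P \<noteq> 0\<close>] less.prems by simp
    qed
    then show ?thesis by (intro exI[of _ 0]) simp
  qed
qed

lemma power_of_prime_additive:
  fixes x y :: "'a::{field, finite}"
  assumes "prime p" "CARD('a) = p ^ f"
  shows "(x + y) ^ (p ^ i) = x ^ (p ^ i) + y ^ (p ^ i)"
  using CHAR_finite_field[OF assms] assms(1) freshmans_dream'[of "p ^ i" i x y] by simp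

lemma power_of_prime_eq_iff:
  fixes x y :: "'a::{field, finite}"
  assumes "prime p" "CARD('a) = p ^ f"
  shows "x ^ (p ^ i) = y ^ (p ^ i) \<longleftrightarrow> x = y"
proof
  assume "x ^ (p ^ i) = y ^ (p ^ i)"
  then have "(x - y) ^ (p ^ i) = 0"
    using power_of_prime_additive[OF assms, of "x - y" y i] by simp
  then show "x = y" by simp
qed auto

lemma of_nat_power_prime:
  assumes "prime p" "CARD('a::{field, finite}) = p ^ f"
  shows "(of_nat k :: 'a) ^ (p ^ i) = of_nat k"
proof (induction k)
  case 0
  show ?case using prime_gt_0_nat[OF assms(1)] by (simp add: power_0_left)
next
  case (Suc k)
  then show ?case using power_of_prime_additive[OF assms, of 1 "of_nat k"] by simp
qed

text \<open>The \<open>p\<close> distinct multiples of \<open>1\<close> are roots of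
  \<open>X ^ p - X\<close>, which leaves no room for others.\<close>

lemma prime_subfield_eq:
  assumes "prime p" "CARD('a::{field, finite}) = p ^ f"
  shows "(prime_subfield :: 'a set) = {x. x ^ p = x}" "card (prime_subfield :: 'a set) = p"
proof -
  have char: "CHAR('a) = p" using assms by (rule CHAR_finite_field)
  have "p > 1" using assms(1) prime_gt_1_nat by blast
  have "inj_on (of_nat :: nat \<Rightarrow> 'a) {..<p}"
    by (auto simp: inj_on_def of_nat_eq_iff_cong_CHAR char cong_def)
  then have image: "card ((of_nat :: nat \<Rightarrow> 'a) ` {..<p}) = p" by (simp add: card_image)
  have sub: "(of_nat :: nat \<Rightarrow> 'a) ` {..<p} \<subseteq> prime_subfield" "prime_subfield \<subseteq> {x :: 'a. x ^ p = x}"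
    using of_nat_power_prime[OF assms, of _ 1] by (auto simp: prime_subfield_def)
  define P :: "'a poly" where "P = monom 1 p - monom 1 1"
  have "coeff P p = 1" using \<open>p > 1\<close> by (simp add: P_def)
  then have "P \<noteq> 0" by auto
  have "degree P \<le> p"
    unfolding P_def using \<open>p > 1\<close> by (intro degree_diff_le degree_monom_le order.trans[OF degree_monom_le]) auto
  moreover have "{x. poly P x = 0} = {x. x ^ p = x}" by (simp add: P_def poly_monom)
  ultimately have "card {x :: 'a. x ^ p = x} \<le> p"
    using card_poly_roots_bound[OF \<open>P \<noteq> 0\<close>] by simp
  then have "(of_nat :: nat \<Rightarrow> 'a) ` {..<p} = {x. x ^ p = x}"
    using image sub by (intro card_seteq) auto
  then show "(prime_subfield :: 'a set) = {x. x ^ p = x}" using sub by auto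
  with \<open>of_nat ` {..<p} = {x. x ^ p = x}\<close> image show "card (prime_subfield :: 'a set) = p" by simp
qed

text \<open>An automorphism is determined by its value \<open>g ^ k\<close> at a generator, hence
  equals \<open>x ^ k\<close> everywhere, and additivity makes \<open>k\<close> a power of
  \<open>p\<close>. Two such powers differ as maps because their exponents are below
  \<open>CARD('a)\<close>.\<close>

lemma Gal_eq_frobenius_powers:
  assumes "prime p" "CARD('a::{field, finite}) = p ^ f" "f > 0"
  shows "(Gal :: ('a \<Rightarrow> 'a) set) = (\<lambda>i x. x ^ (p ^ i)) ` {..<f}"
    and "inj_on (\<lambda>i (x::'a). x ^ (p ^ i)) {..<f}"
proof -
  have "p > 1" using assms(1) prime_gt_1_nat by blast
  obtain g :: 'a where g: "g \<noteq> 0" "g ^ (CARD('a) - 1) = 1" "inj_on (\<lambda>i. g ^ i) {..<CARD('a) - 1}"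
    "\<And>x. x \<noteq> 0 \<Longrightarrow> \<exists>i<CARD('a) - 1. x = g ^ i"
    by (rule finite_field_generator[where 'a = 'a]) (rule that)
  show "(Gal :: ('a \<Rightarrow> 'a) set) = (\<lambda>i x. x ^ (p ^ i)) ` {..<f}"
  proof (intro equalityI subsetI)
    fix \<sigma> :: "'a \<Rightarrow> 'a" assume \<sigma>: "\<sigma> \<in> Gal"
    then have add: "\<sigma> (x + y) = \<sigma> x + \<sigma> y" and mult: "\<sigma> (x * y) = \<sigma> x * \<sigma> y" for x y
      by (auto simp: Gal_def)
    have "inj \<sigma>" using \<sigma> by (auto simp: Gal_def bij_def)
    have [simp]: "\<sigma> 0 = 0" using add[of 0 0] by (simp only: add_0_left add_cancel_right_right)
    have "\<sigma> g \<noteq> 0" using \<open>inj \<sigma>\<close> g(1) by (metis \<open>\<sigma> 0 = 0\<close> injD)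
    then obtain k0 where k0: "k0 < CARD('a) - 1" "\<sigma> g = g ^ k0" using g(4) by blast
    have [simp]: "\<sigma> 1 = 1" using mult[of 1 g] \<open>\<sigma> g \<noteq> 0\<close> by simp
    have pow: "\<sigma> (x ^ i) = \<sigma> x ^ i" for x i by (induction i) (simp_all add: mult)
    \<comment> \<open>The exponent \<open>0\<close> is replaced by \<open>CARD('a) - 1\<close>,
      which gives the same power of \<open>g\<close>, so that \<open>0 ^ k = 0\<close>.\<close>
    define k where "k = (if k0 = 0 then CARD('a) - 1 else k0)"
    have "CARD('a) > 1" using assms one_less_power[OF \<open>p > 1\<close>] by simp
    then have k: "0 < k" "k < CARD('a)" "\<sigma> g = g ^ k"
      using k0 g(2) by (auto simp: k_def)
    have \<sigma>_eq: "\<sigma> x = x ^ k" for x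
    proof (cases "x = 0")
      case False
      then obtain i where "x = g ^ i" using g(4) by blast
      then show ?thesis by (simp add: pow k(3) mult.commute flip: power_mult)
    qed (use k in \<open>simp add: power_0_left\<close>)
    obtain i where i: "k = p ^ i"
      using additive_power_exponent[OF assms(1,2) k(1,2)] add unfolding \<sigma>_eq by blast
    then have "i < f" using k(2) assms(2) \<open>p > 1\<close> by simp
    then show "\<sigma> \<in> (\<lambda>i x. x ^ (p ^ i)) ` {..<f}"
      using \<sigma>_eq i by auto
  next
    fix \<sigma> :: "'a \<Rightarrow> 'a" assume "\<sigma> \<in> (\<lambda>i x. x ^ (p ^ i)) ` {..<f}"
    then obtain i where i: "\<sigma> = (\<lambda>x. x ^ (p ^ i))" by blast
    have "inj \<sigma>" unfolding i using power_of_prime_eq_iff[OF assms(1,2)] by (auto intro: injI)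
    then have "bij \<sigma>" by (simp add: bij_def finite_UNIV_inj_surj)
    then show "\<sigma> \<in> Gal"
      using power_of_prime_additive[OF assms(1,2)] of_nat_power_prime[OF assms(1,2)]
      by (auto simp: Gal_def i prime_subfield_def power_mult_distrib)
  qed
  show "inj_on (\<lambda>i (x::'a). x ^ (p ^ i)) {..<f}"
  proof (rule inj_onI)
    fix i j assume ij: "i \<in> {..<f}" "j \<in> {..<f}" "(\<lambda>x::'a. x ^ (p ^ i)) = (\<lambda>x. x ^ (p ^ j))"
    have eq: "x ^ (p ^ i) = x ^ (p ^ j)" for x :: 'a using ij(3) by meson
    define P :: "'a poly" where "P = monom 1 (p ^ i) - monom 1 (p ^ j)"
    have "degree P < CARD('a)"
      unfolding P_def using ij(1,2) \<open>p > 1\<close> assms(2)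
      by (intro degree_diff_less) (simp_all add: degree_monom_eq)
    moreover have "{x. poly P x = 0} = UNIV" using eq by (simp add: P_def poly_monom)
    ultimately have "P = 0" using card_poly_roots_bound[of P] by (metis not_le)
    then have "(monom 1 (p ^ i) :: 'a poly) = monom 1 (p ^ j)" by (simp add: P_def)
    then have "p ^ i = p ^ j" by (metis degree_monom_eq one_neq_zero)
    then show "i = j" using \<open>p > 1\<close> by simp
  qed
qed

section \<open>Trace, norm and additive character\<close>

lemma field_trace_eq:
  assumes "prime p" "CARD('a::{field, finite}) = p ^ f" "f > 0"
  shows "field_trace (a :: 'a) = (\<Sum>i<f. a ^ (p ^ i))"
  unfolding field_trace_def Gal_eq_frobenius_powers(1)[OF assms]
  by (simp add: sum.reindex Gal_eq_frobenius_powers(2)[OF assms])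

lemma power_minus_1_eq_mult_sum:
  fixes p :: nat
  assumes "p > 0"
  shows "p ^ f - 1 = (p - 1) * (\<Sum>i<f. p ^ i)"
proof (induction f)
  case (Suc f)
  have "p ^ Suc f - 1 = (p - 1) * p ^ f + (p ^ f - 1)"
    using assms by (simp add: diff_mult_distrib)
  also have "\<dots> = (p - 1) * p ^ f + (p - 1) * (\<Sum>i<f. p ^ i)" by (simp only: Suc)
  finally show ?case by (simp add: distrib_left)
qed simp

lemma sum_powers_eq_div:
  fixes p :: nat
  assumes "p > 1"
  shows "(\<Sum>i<f. p ^ i) = (p ^ f - 1) div (p - 1)"
  using assms power_minus_1_eq_mult_sum[of p f] by simp

lemma field_norm_eq:
  assumes "prime p" "CARD('a::{field, finite}) = p ^ f" "f > 0"
  shows "field_norm (a :: 'a) = a ^ ((p ^ f - 1) div (p - 1))"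
  unfolding field_norm_def Gal_eq_frobenius_powers(1)[OF assms]
    sum_powers_eq_div[OF prime_gt_1_nat[OF assms(1)], symmetric]
  by (simp add: prod.reindex Gal_eq_frobenius_powers(2)[OF assms] power_sum)

definition trace_rep :: "'a::{field, finite} \<Rightarrow> nat" where
  "trace_rep a = (LEAST k. of_nat k = field_trace a)"

lemma add_char_eq: "add_char \<zeta> a = \<zeta> ^ trace_rep a"
  by (simp add: add_char_def trace_rep_def)

text \<open>The Frobenius map permutes the summands of the trace cyclically, as
  \<open>a ^ (p ^ f) = a\<close>, so the trace lies in the prime subfield.\<close>

lemma trace_rep:
  assumes "prime p" "CARD('a::{field, finite}) = p ^ f" "f > 0"
  shows "of_nat (trace_rep (a :: 'a)) = field_trace a" "trace_rep a < p"
proof -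
  have char: "CHAR('a) = p" using assms(1,2) by (rule CHAR_finite_field)
  have "(field_trace a) ^ p = (\<Sum>i<f. (a ^ (p ^ i)) ^ p)"
    unfolding field_trace_eq[OF assms]
    using assms(1) by (intro freshmans_dream_sum) (simp_all add: char)
  also have "\<dots> = (\<Sum>i<f. a ^ (p ^ Suc i))"
    by (simp add: mult.commute flip: power_mult)
  also have "\<dots> = (\<Sum>i<f. a ^ (p ^ i))"
  proof -
    have "a ^ (p ^ f) = a" using finite_field_power_card[of a] assms(2) by simp
    then have "(\<Sum>i<Suc f. a ^ (p ^ i)) = a + (\<Sum>i<f. a ^ (p ^ i))" by simp
    then show ?thesis unfolding sum.lessThan_Suc_shift by simp
  qed
  finally have "field_trace a \<in> prime_subfield"
    by (simp add: prime_subfield_eq[OF assms(1,2)] field_trace_eq[OF assms])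
  then have "\<exists>k. of_nat k = field_trace a" by (auto simp: prime_subfield_def)
  from LeastI_ex[OF this] show *: "of_nat (trace_rep a) = field_trace a"
    by (simp add: trace_rep_def)
  \<comment> \<open>Reduction modulo \<open>p\<close> gives another representative, so the least one
    is below \<open>p\<close>.\<close>
  have "of_nat (trace_rep a mod p) = field_trace a"
    unfolding *[symmetric] by (simp add: of_nat_eq_iff_cong_CHAR char)
  then have "trace_rep a \<le> trace_rep a mod p" unfolding trace_rep_def by (rule Least_le)
  then show "trace_rep a < p"
    using prime_gt_0_nat[OF assms(1)] by (meson le_less_trans mod_less_divisor)
qed

lemma trace_rep_eq_iff:
  assumes "prime p" "CARD('a::{field, finite}) = p ^ f" "f > 0"
  shows "trace_rep (a :: 'a) = trace_rep b \<longleftrightarrow> field_trace a = field_trace b"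
proof
  assume "trace_rep a = trace_rep b"
  then show "field_trace a = field_trace b"
    using trace_rep(1)[OF assms, of a] trace_rep(1)[OF assms, of b] by (simp only:)
qed (simp add: trace_rep_def)

text \<open>The trace is linear over the prime subfield, so a scalar acts on the additive character
  as an exponent on \<zeta>.\<close>

lemma add_char_of_nat_mult:
  assumes "prime p" "CARD('a::{field, finite}) = p ^ f" "f > 0" "\<zeta> ^ p = 1"
  shows "add_char \<zeta> (of_nat l * (a :: 'a)) = \<zeta> ^ (l * trace_rep a)"
proof -
  have "field_trace (of_nat l * a) = of_nat l * field_trace a"
    by (simp add: field_trace_eq[OF assms(1-3)] power_mult_distrib
        of_nat_power_prime[OF assms(1,2)] sum_distrib_left)
  then have "(of_nat (trace_rep (of_nat l * a)) :: 'a) = of_nat (l * trace_rep a)"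
    by (simp add: trace_rep(1)[OF assms(1-3)])
  then have "[trace_rep (of_nat l * a) = l * trace_rep a] (mod p)"
    using CHAR_finite_field[OF assms(1,2)] by (simp only: of_nat_eq_iff_cong_CHAR)
  then show ?thesis
    unfolding add_char_eq by (rule power_cong_exponent[OF assms(4)])
qed


subsection \<open>Characters on the norm fibres\<close>

lemma power_eq_iff_cong_of_inj:
  fixes x :: "'a :: comm_monoid_mult"
  assumes "x ^ m = 1" "m > 0" "inj_on (\<lambda>i. x ^ i) {..<m}"
  shows "x ^ i = x ^ j \<longleftrightarrow> [i = j] (mod m)"
proof
  assume "x ^ i = x ^ j"
  moreover have "x ^ k = x ^ (k mod m)" for k
    by (rule power_cong_exponent[OF assms(1)]) (simp add: cong_def)
  ultimately have "x ^ (i mod m) = x ^ (j mod m)" by metis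
  then have "i mod m = j mod m"
    by (rule inj_onD[OF assms(3)]) (use assms(2) in auto)
  then show "[i = j] (mod m)" by (simp add: cong_def)
qed (rule power_cong_exponent[OF assms(1)])

lemma cis_power_eq_1_iff:
  fixes m k :: nat
  assumes "m > 0"
  shows "cis (2 * pi / m) ^ k = 1 \<longleftrightarrow> m dvd k"
proof -
  have pow: "cis (2 * pi / m) ^ k = cis (2 * pi * k / m)" for k
    by (simp add: DeMoivre mult_ac)
  have "inj_on (\<lambda>k. cis (2 * pi * real k / real m)) {..<m}"
    using bij_betw_roots_unity[OF assms] by (rule bij_betw_imp_inj_on)
  then have "inj_on (\<lambda>k. cis (2 * pi / m) ^ k) {..<m}" by (simp add: pow)
  moreover have "cis (2 * pi / m) ^ m = 1" using assms by (simp add: pow)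
  ultimately show ?thesis
    using power_eq_iff_cong_of_inj[of "cis (2 * pi / m)" m k 0] assms by (simp add: cong_0_iff)
qed

lemma mult_char_UNIV:
  assumes "mult_char UNIV chi"
  shows "chi 1 = 1" "x \<noteq> 0 \<Longrightarrow> chi (x ^ k) = chi x ^ k"
    "x \<noteq> 0 \<Longrightarrow> y \<noteq> 0 \<Longrightarrow> chi (x * y) = chi x * chi y"
proof -
  show mult: "chi (x * y) = chi x * chi y" if "x \<noteq> 0" "y \<noteq> 0" for x y
    using assms that by (simp add: mult_char_def)
  have "card {0, 1 :: 'a} \<le> CARD('a)" by (intro card_mono) auto
  then have "CARD('a) - 1 > 0" by simp
  moreover have "chi 1 ^ (CARD('a) - 1) = 1"
    using assms by (simp add: mult_char_def roots_of_unity_def)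
  ultimately have "chi 1 \<noteq> 0" by (metis power_0_left less_irrefl zero_neq_one)
  then show one: "chi 1 = 1" using mult[of 1 1] by simp
  show "chi (x ^ k) = chi x ^ k" if "x \<noteq> 0" for x k
    by (induction k) (simp_all add: one mult that)
qed

section \<open>Splitting of the multiplicative group when the norm index is prime\<close>

locale prime_norm_index =
  fixes p f n :: nat and g :: "'a::{field, finite}"
  assumes p: "prime p" and f: "f \<ge> 2" and card: "CARD('a) = p ^ f"
    and n_def: "n = (p ^ f - 1) div (p - 1)" and n: "prime n"
    and g_nz: "g \<noteq> 0" and g_order: "g ^ (CARD('a) - 1) = 1"
    and g_inj: "inj_on (\<lambda>i. g ^ i) {..<CARD('a) - 1}"
    and g_gen: "\<And>x. x \<noteq> 0 \<Longrightarrow> \<exists>i<CARD('a) - 1. x = g ^ i"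
begin

lemma f_pos: "f > 0" using f by simp

lemma p_gt_1: "p > 1" using p by (rule prime_gt_1_nat)

lemma n_eq_sum: "n = (\<Sum>i<f. p ^ i)"
  unfolding n_def using p_gt_1 by (rule sum_powers_eq_div[symmetric])

lemma card_eq: "CARD('a) - 1 = n * (p - 1)"
  unfolding card n_eq_sum using power_minus_1_eq_mult_sum[of p f] p_gt_1 by (simp add: mult.commute)

text \<open>\<open>n\<close> is the sum of all \<open>p ^ i\<close> with \<open>i < f\<close>, and
  \<open>f \<ge> 2\<close> provides a further positive summand.\<close>

lemma p_power_less_n:
  assumes "i < f"
  shows "p ^ i < n"
proof -
  obtain j where j: "j < f" "j \<noteq> i"
    using f that[of "if i = 0 then 1 else 0"] by (simp split: if_splits)
  have "p ^ i < p ^ i + p ^ j" using p_gt_1 by simp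
  also have "\<dots> = (\<Sum>k\<in>{i, j}. p ^ k)" using j by simp
  also have "\<dots> \<le> n" unfolding n_eq_sum using j assms by (intro sum_mono2) auto
  finally show ?thesis .
qed

lemma p_less_n: "p < n"
  using p_power_less_n[of 1] f by simp

lemma char_p: "CHAR('a) = p"
  using p card by (rule CHAR_finite_field)

lemma of_nat_n_nz: "of_nat n \<noteq> (0 :: 'a)"
  using p_less_n primes_dvd_imp_eq[OF p n] by (auto simp: of_nat_eq_0_iff_char_dvd char_p)

lemma coprime_p1_n: "coprime (p - 1) n"
  using p_less_n p_gt_1 by (auto simp: prime_coprime_right_iff[OF n] dest: dvd_imp_le)

lemma g_eq_iff: "g ^ i = g ^ j \<longleftrightarrow> [i = j] (mod n * (p - 1))"
proof -
  have "n * (p - 1) > 0" using p_gt_1 prime_gt_0_nat[OF n] by simp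
  then show ?thesis
    using power_eq_iff_cong_of_inj[of g "n * (p - 1)"] g_order g_inj card_eq by simp
qed

text \<open>\<open>u\<close> generates the kernel of the norm and \<open>v\<close> generates \<open>\<bbbF>\<^sub>p\<^sup>\<times>\<close>.\<close>

definition u :: 'a where "u = g ^ (p - 1)"

definition v :: 'a where "v = g ^ n"

lemma u_nz: "u \<noteq> 0" and v_nz: "v \<noteq> 0"
  using g_nz by (simp_all add: u_def v_def)

lemma u_eq_iff: "u ^ i = u ^ j \<longleftrightarrow> [i = j] (mod n)"
proof -
  have "u ^ i = u ^ j \<longleftrightarrow> [(p - 1) * i = (p - 1) * j] (mod (p - 1) * n)"
    unfolding u_def power_mult[symmetric] g_eq_iff by (simp add: mult.commute)
  also have "\<dots> \<longleftrightarrow> [i = j] (mod n)"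
    using p_gt_1 by (simp add: cong_def flip: mult_mod_right)
  finally show ?thesis .
qed

lemma v_eq_iff: "v ^ i = v ^ j \<longleftrightarrow> [i = j] (mod p - 1)"
  unfolding v_def power_mult[symmetric] g_eq_iff
  using prime_gt_0_nat[OF n] by (simp add: cong_def flip: mult_mod_right)

lemma u_order: "u ^ n = 1" "u \<noteq> 1"
  using u_eq_iff[of n 0] u_eq_iff[of 1 0] prime_gt_1_nat[OF n] by (simp_all add: cong_def)

lemma v_order: "v ^ (p - 1) = 1"
  using v_eq_iff[of "p - 1" 0] by (simp add: cong_def)

text \<open>The Frobenius map fixes \<open>g ^ i\<close> exactly when \<open>n * (p - 1)\<close>
  divides \<open>i * (p - 1)\<close>, that is, when \<open>n\<close> divides
  \<open>i\<close>.\<close>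

lemma prime_subfield_iff: "x \<in> prime_subfield \<and> x \<noteq> 0 \<longleftrightarrow> (\<exists>r. x = v ^ r)"
proof
  assume x: "x \<in> prime_subfield \<and> x \<noteq> 0"
  then obtain i where i: "x = g ^ i" using g_gen by blast
  have "x ^ p = x" using x prime_subfield_eq(1)[OF p card] by blast
  then have "g ^ (i * p) = g ^ i" by (simp add: i flip: power_mult)
  then have "[i * (p - 1) + i = 0 + i] (mod n * (p - 1))"
    unfolding g_eq_iff using p_gt_1 by (simp add: diff_mult_distrib2)
  then have "n * (p - 1) dvd i * (p - 1)"
    by (simp only: cong_add_rcancel_nat cong_0_iff)
  then have "n dvd i" using p_gt_1 by simp
  then obtain r where "i = n * r" by (rule dvdE)
  then show "\<exists>r. x = v ^ r" by (auto simp: i v_def power_mult)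
next
  assume "\<exists>r. x = v ^ r"
  then obtain r where r: "x = v ^ r" ..
  have "v ^ p = v ^ (p - 1) * v" using p_gt_1 by (simp add: power_eq_if mult.commute)
  then have "v ^ p = v" by (simp only: v_order mult_1_left)
  then have "x ^ p = x" unfolding r by (metis mult.commute power_mult)
  then show "x \<in> prime_subfield \<and> x \<noteq> 0"
    using v_nz r prime_subfield_eq(1)[OF p card] by auto
qed

lemma field_norm_eq_power: "field_norm (a :: 'a) = a ^ n"
  unfolding n_def by (rule field_norm_eq[OF p card f_pos])

text \<open>Division by \<open>b\<close> reduces to \<open>a ^ n = 1\<close>, which holds for
  \<open>a = g ^ k\<close> exactly when \<open>p - 1\<close> divides \<open>k\<close>.\<close>

lemma norm_fibre:
  assumes "b \<noteq> 0"
  shows "bij_betw (\<lambda>s. b * u ^ s) {..<n} {a. a \<noteq> 0 \<and> a ^ n = b ^ n}"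
proof (rule bij_betw_imageI)
  show "inj_on (\<lambda>s. b * u ^ s) {..<n}"
    using assms by (auto simp: inj_on_def u_eq_iff cong_def)
  show "(\<lambda>s. b * u ^ s) ` {..<n} = {a. a \<noteq> 0 \<and> a ^ n = b ^ n}"
  proof (intro equalityI subsetI)
    fix a assume "a \<in> (\<lambda>s. b * u ^ s) ` {..<n}"
    then obtain s where "a = b * u ^ s" by blast
    moreover have "(u ^ s) ^ n = 1" using u_order(1) by (metis mult.commute power_mult power_one)
    ultimately show "a \<in> {a. a \<noteq> 0 \<and> a ^ n = b ^ n}"
      using assms u_nz by (simp add: power_mult_distrib)
  next
    fix a assume a: "a \<in> {a. a \<noteq> 0 \<and> a ^ n = b ^ n}"
    then obtain k where k: "a / b = g ^ k" using assms g_gen[of "a / b"] by auto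
    have "(a / b) ^ n = 1" using a assms by (simp add: power_divide)
    then have "g ^ (k * n) = g ^ 0" by (simp add: k flip: power_mult)
    then have "n * (p - 1) dvd k * n" unfolding g_eq_iff by (simp add: cong_0_iff)
    then have "p - 1 dvd k" using prime_gt_0_nat[OF n] by (simp add: mult.commute)
    then obtain s where "k = (p - 1) * s" by (rule dvdE)
    then have "a / b = u ^ s" by (simp add: k u_def power_mult)
    also have "\<dots> = u ^ (s mod n)" by (simp add: u_eq_iff cong_def)
    finally have "a = b * u ^ (s mod n)" using assms by (simp add: field_simps)
    then show "a \<in> (\<lambda>s. b * u ^ s) ` {..<n}" using prime_gt_0_nat[OF n] by auto
  qed
qed

text \<open>A Bezout relation between the coprime numbers \<open>p - 1\<close> and \<open>n\<close>
  expresses \<open>g\<close> by powers of \<open>u\<close> and \<open>v\<close>.\<close>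

lemma decompose:
  assumes "a \<noteq> 0"
  obtains s r where "a = u ^ s * v ^ r"
proof -
  obtain i where i: "a = g ^ i" using g_gen[OF assms] by blast
  have "p - 1 \<noteq> 0" using p_gt_1 by simp
  obtain x y where "(p - 1) * x = n * y + 1"
    using bezout_nat[OF \<open>p - 1 \<noteq> 0\<close>, of n] coprime_imp_gcd_eq_1[OF coprime_p1_n] by auto
  then have "g ^ ((p - 1) * x) = g ^ (n * y + 1)" by (rule arg_cong)
  then have ux: "u ^ x = v ^ y * g" by (simp only: u_def v_def power_mult power_add power_one_right)
  \<comment> \<open>\<open>p - 2\<close> acts as \<open>-1\<close> modulo the order
    \<open>p - 1\<close> of \<open>v\<close>, so \<open>v ^ z\<close> inverts
    \<open>v ^ y\<close>.\<close>
  define z where "z = y * (p - 2)"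
  have "y * (p - 2) + y = y * (p - 1)"
    using p_gt_1 by (metis Suc_1 Suc_diff_Suc add.commute mult_Suc_right numeral_2_eq_2 One_nat_def)
  then have "v ^ z * v ^ y = v ^ (y * (p - 1))" by (simp add: z_def flip: power_add)
  also have "\<dots> = 1" using v_order by (metis mult.commute power_mult power_one)
  finally have "u ^ x * v ^ z = g" unfolding ux by (simp add: mult_ac)
  then have "a = (u ^ x * v ^ z) ^ i" by (simp add: i)
  also have "\<dots> = u ^ (x * i) * v ^ (z * i)" by (simp add: power_mult_distrib power_mult)
  finally show thesis by (rule that)
qed

text \<open>Orthogonality of the characters of \<open>\<bbbF>\<^sub>p\<^sup>\<times>\<close> isolates the norm fibre through \<open>v ^ r\<close>.\<close>

lemma norm_fibre_sum_eq_0: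
  fixes F :: "'a \<Rightarrow> complex"
  assumes F: "\<And>\<eta>. mult_char prime_subfield \<eta> \<Longrightarrow> (\<Sum>a\<in>UNIV - {0}. F a * norm_lift \<eta> a) = 0"
  shows "(\<Sum>s<n. F (v ^ r * u ^ s)) = 0"
proof -
  define m where "m = p - 1"
  have "m > 0" using p_gt_1 by (simp add: m_def)
  define \<epsilon> where "\<epsilon> = cis (2 * pi / m)"
  have order: "\<epsilon> ^ k = 1 \<longleftrightarrow> m dvd k" for k
    unfolding \<epsilon>_def by (rule cis_power_eq_1_iff[OF \<open>m > 0\<close>])
  \<comment> \<open>A discrete logarithm to base \<open>v\<close>, determined modulo
    \<open>m\<close> on nonzero elements of the prime subfield.\<close>
  define L where "L = (\<lambda>x. SOME i. x = v ^ i)"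
  have L: "v ^ L x = x" if "x \<in> prime_subfield \<and> x \<noteq> 0" for x
    using that someI_ex[of "\<lambda>i. x = v ^ i"] unfolding prime_subfield_iff L_def by metis
  have norm: "a ^ n \<in> prime_subfield \<and> a ^ n \<noteq> 0" if nz: "a \<noteq> 0" for a :: 'a
  proof -
    obtain i where "a = g ^ i" using g_gen[OF nz] by blast
    then have "a ^ n = v ^ i" by (simp add: v_def mult.commute flip: power_mult)
    then show ?thesis unfolding prime_subfield_iff by blast
  qed
  \<comment> \<open>The powers of the character \<open>\<lambda>x. \<epsilon> ^ L x\<close> serve as
    \<eta>.\<close>
  have "(\<Sum>a\<in>UNIV - {0}. F a * \<epsilon> ^ (l * L (a ^ n))) = 0" for l
  proof -
    have "mult_char prime_subfield (\<lambda>x :: 'a. \<epsilon> ^ (l * L x))"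
      unfolding mult_char_def
    proof (intro conjI ballI)
      fix a :: 'a
      show "\<epsilon> ^ (l * L a) \<in> roots_of_unity (card (prime_subfield :: 'a set) - 1)"
        unfolding prime_subfield_eq(2)[OF p card] roots_of_unity_def m_def[symmetric]
        by (simp add: order flip: power_mult)
    next
      fix a b :: 'a assume ab: "a \<in> prime_subfield - {0}" "b \<in> prime_subfield - {0}"
      then have "\<exists>i. a = v ^ i" "\<exists>j. b = v ^ j" using prime_subfield_iff by blast+
      then have "\<exists>k. a * b = v ^ k" by (metis power_add)
      then have "v ^ L (a * b) = a * b" using L prime_subfield_iff by blast
      also have "\<dots> = v ^ (L a + L b)" using L ab by (simp add: power_add)
      finally have "[L (a * b) = L a + L b] (mod m)" unfolding v_eq_iff m_def .
      then have "[l * L (a * b) = l * (L a + L b)] (mod m)" by (rule cong_scalar_left)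
      moreover have "\<epsilon> ^ m = 1" using order by simp
      ultimately have "\<epsilon> ^ (l * L (a * b)) = \<epsilon> ^ (l * (L a + L b))"
        by (intro power_cong_exponent)
      then show "\<epsilon> ^ (l * L (a * b)) = \<epsilon> ^ (l * L a) * \<epsilon> ^ (l * L b)"
        by (simp add: distrib_left power_add)
    qed
    from F[OF this] show ?thesis by (simp add: norm_lift_def field_norm_eq_power)
  qed
  \<comment> \<open>The norm of \<open>v ^ r\<close> is \<open>v ^ (n * r)\<close>, hence the
    residue \<open>n * r\<close>.\<close>
  then have "of_nat m * (\<Sum>a | a \<in> UNIV - {0} \<and> [L (a ^ n) = n * r] (mod m). F a) = 0"
    using fourier_inversion[OF order \<open>m > 0\<close>, of "UNIV - {0}" "n * r" F "\<lambda>a. L (a ^ n)"] by simp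
  then have "(\<Sum>a | a \<in> UNIV - {0} \<and> [L (a ^ n) = n * r] (mod m). F a) = 0"
    using \<open>m > 0\<close> by simp
  moreover have "{a. a \<in> UNIV - {0} \<and> [L (a ^ n) = n * r] (mod m)} = {a. a \<noteq> 0 \<and> a ^ n = (v ^ r) ^ n}"
  proof -
    have "[L (a ^ n) = n * r] (mod m) \<longleftrightarrow> a ^ n = (v ^ r) ^ n" if "a \<noteq> 0" for a
      using v_eq_iff[of "L (a ^ n)" "n * r"] L[OF norm[OF that]]
      by (simp add: m_def mult.commute flip: power_mult)
    then show ?thesis by auto
  qed
  ultimately have "(\<Sum>a\<in>{a. a \<noteq> 0 \<and> a ^ n = (v ^ r) ^ n}. F a) = 0" by simp
  then show ?thesis
    using sum.reindex_bij_betw[OF norm_fibre[of "v ^ r"], of F] v_nz by simp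
qed

text \<open>Represented by an integer prime to \<open>p\<close>, a scalar can act on \<zeta> as a
  Galois conjugation.\<close>

lemma v_power_of_nat:
  obtains l where "v ^ r = of_nat l" "coprime l p"
proof -
  have "v ^ r \<in> prime_subfield \<and> v ^ r \<noteq> 0" unfolding prime_subfield_iff by blast
  then obtain l where l: "v ^ r = of_nat l"
    by (auto simp: prime_subfield_def)
  then have "(of_nat l :: 'a) \<noteq> 0" using v_nz by (metis power_not_zero)
  then have "coprime l p"
    by (simp add: of_nat_eq_0_iff_char_dvd char_p prime_coprime_right_iff[OF p])
  with l show thesis by (rule that)
qed

lemma field_trace_u: "field_trace (u ^ s) = (\<Sum>i<f. u ^ (s * p ^ i))"
  by (simp add: field_trace_eq[OF p card f_pos] power_mult)

end

section \<open>Characters with equal twisted Gauss sums\<close>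

theorem proposition3p10:
  fixes p f :: nat and \<zeta> :: complex and chi chi' :: "'a::{field, finite} \<Rightarrow> complex"
  assumes "prime p" and "f \<ge> 2" and "CARD('a) = p ^ f"
    and "prime ((p ^ f - 1) div (p - 1))"
    and "roots_of_unity p = range (\<lambda>k::nat. \<zeta> ^ k)"
    and "mult_char UNIV chi" and "mult_char UNIV chi'"
    and "\<And>\<eta> :: 'a \<Rightarrow> complex. mult_char prime_subfield \<eta> \<Longrightarrow>
           gauss_sum \<zeta> (\<lambda>a. chi a * norm_lift \<eta> a) = gauss_sum \<zeta> (\<lambda>a. chi' a * norm_lift \<eta> a)"
  shows "frobenius_conjugate chi chi'"
proof -
  define n where "n = (p ^ f - 1) div (p - 1)"
  obtain g :: 'a where g: "g \<noteq> 0" "g ^ (CARD('a) - 1) = 1"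
    "inj_on (\<lambda>i. g ^ i) {..<CARD('a) - 1}" "\<And>x. x \<noteq> 0 \<Longrightarrow> \<exists>i<CARD('a) - 1. x = g ^ i"
    by (rule finite_field_generator[where 'a = 'a]) (rule that)
  interpret prime_norm_index p f n g
    by unfold_locales (use assms(1-4) g in \<open>simp_all add: n_def\<close>)
  have \<zeta>: "\<zeta> ^ p = 1" "\<zeta> \<noteq> 1"
  proof -
    have "\<zeta> ^ 1 \<in> roots_of_unity p" unfolding assms(5) by (rule rangeI)
    then show "\<zeta> ^ p = 1" by (simp add: roots_of_unity_def)
    show "\<zeta> \<noteq> 1"
    proof
      assume "\<zeta> = 1"
      then have "roots_of_unity p = {1}" using assms(5) by auto
      moreover have "card (roots_of_unity p) = p"
        unfolding roots_of_unity_def using p_gt_1 by (intro card_roots_unity_eq) simp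
      ultimately show False using p_gt_1 by simp
    qed
  qed
  note chi = mult_char_UNIV[OF assms(6)] and chi' = mult_char_UNIV[OF assms(7)]
  define \<omega> \<omega>' where "\<omega> = chi u" and "\<omega>' = chi' u"
  have roots: "\<omega> ^ n = 1" "\<omega>' ^ n = 1"
    using chi(2)[OF u_nz, of n] chi'(2)[OF u_nz, of n] chi(1) chi'(1) u_order(1)
    by (simp_all add: \<omega>_def \<omega>'_def)
  define t where "t = (\<lambda>s. trace_rep (u ^ s))"
  note trace_rep = trace_rep[OF p card f_pos]
  have t_less: "t s < p" for s by (simp add: t_def trace_rep)
  have t_cong: "t s = t s'" if "[s = s'] (mod n)" for s s'
    using that by (simp add: t_def flip: u_eq_iff)
  have t_eq_iff: "t s = t s' \<longleftrightarrow> field_trace (u ^ s) = field_trace (u ^ s')" for s s'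
    unfolding t_def by (rule trace_rep_eq_iff[OF p card f_pos])
  have "n \<noteq> p" using p_less_n by simp

  \<comment> \<open>The difference of the Gauss sums is restricted to the norm fibre through
    \<open>v ^ r\<close>, where \<open>add_char\<close> has the exponent
    \<open>l * t s\<close>.\<close>
  have twisted: "chi (v ^ r) * (\<Sum>s<n. \<omega> ^ s * \<zeta> ^ (l * t s))
      = chi' (v ^ r) * (\<Sum>s<n. \<omega>' ^ s * \<zeta> ^ (l * t s))" if "v ^ r = of_nat l" for r l
  proof -
    have "(\<Sum>s<n. (chi (v ^ r * u ^ s) - chi' (v ^ r * u ^ s)) * add_char \<zeta> (v ^ r * u ^ s)) = 0"
    proof (rule norm_fibre_sum_eq_0)
      fix \<eta> :: "'a \<Rightarrow> complex" assume "mult_char prime_subfield \<eta>"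
      from assms(8)[OF this]
      show "(\<Sum>a\<in>UNIV - {0}. (chi a - chi' a) * add_char \<zeta> a * norm_lift \<eta> a) = 0"
        by (simp add: gauss_sum_def left_diff_distrib right_diff_distrib sum_subtractf mult_ac)
    qed
    moreover have "add_char \<zeta> (v ^ r * u ^ s) = \<zeta> ^ (l * t s)" for s
      unfolding that t_def by (rule add_char_of_nat_mult[OF p card f_pos \<zeta>(1)])
    moreover have "chi (v ^ r * u ^ s) = chi (v ^ r) * \<omega> ^ s"
      "chi' (v ^ r * u ^ s) = chi' (v ^ r) * \<omega>' ^ s" for s
      using u_nz v_nz by (simp_all add: chi(2,3) chi'(2,3) \<omega>_def \<omega>'_def)
    ultimately show ?thesis
      by (simp add: left_diff_distrib sum_subtractf sum_distrib_left mult.assoc)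
  qed
  \<comment> \<open>The fibre through \<open>v ^ 0 = 1\<close>, where both characters take the value
    one.\<close>
  have eq: "(\<Sum>s<n. \<omega> ^ s * \<zeta> ^ t s) = (\<Sum>s<n. \<omega>' ^ s * \<zeta> ^ t s)"
    using twisted[of 0 1] chi(1) chi'(1) by simp

  have nonconst: "\<exists>s<n. t s \<noteq> t 0"
  proof -
    obtain s where "s < n" and ne: "(\<Sum>i<f. u ^ (s * p ^ i)) \<noteq> (\<Sum>i<f. u ^ (0 * p ^ i))"
      using power_sums_nonconstant[OF n u_order of_nat_n_nz p_gt_1 p_power_less_n f_pos] by blast
    from ne have "t s \<noteq> t 0" unfolding t_eq_iff field_trace_u .
    then show ?thesis using \<open>s < n\<close> by blast
  qed

  have chi_v: "chi (v ^ r) = chi' (v ^ r)" for r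
  proof -
    obtain l where l: "v ^ r = of_nat l" "coprime l p" by (rule v_power_of_nat)
    have \<zeta>l: "(\<zeta> ^ l) ^ p = 1" "\<zeta> ^ l \<noteq> 1"
      using \<zeta>(1) power_eq_1_iff_dvd_prime[OF p \<zeta>, of l] prime_coprime_right_iff[OF p, of l] l(2)
      by (metis mult.commute power_mult power_one, simp)
    have "(\<Sum>s<n. \<omega> ^ s * \<zeta> ^ (l * t s)) \<noteq> 0"
      using twisted_sum_nonzero[OF n roots(1) p \<zeta>l \<open>n \<noteq> p\<close> t_less nonconst]
      by (simp add: power_mult)
    \<comment> \<open>Conjugation by \<open>1\<close> on \<open>n\<close>-th roots and by
      \<open>l\<close> on \<open>p\<close>-th roots carries \<open>eq\<close> to the fibre through
      \<open>v ^ r\<close>; the common nonzero sum then cancels in \<open>twisted\<close>.\<close>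
    moreover have "(\<Sum>s<n. (\<omega> ^ s) ^ 1 * (\<zeta> ^ t s) ^ l) = (\<Sum>s<n. (\<omega>' ^ s) ^ 1 * (\<zeta> ^ t s) ^ l)"
    proof (rule root_of_unity_sums_eq_powers[of n p])
      show "coprime n p" using primes_coprime[OF n p \<open>n \<noteq> p\<close>] .
      show "(\<omega> ^ s) ^ n = 1" "(\<omega>' ^ s) ^ n = 1" "(\<zeta> ^ t s) ^ p = 1" for s
        using roots \<zeta>(1) by (metis mult.commute power_mult power_one)+
    qed (use eq l(2) prime_gt_0_nat[OF n] prime_gt_0_nat[OF p] in simp_all)
    then have "(\<Sum>s<n. \<omega> ^ s * \<zeta> ^ (l * t s)) = (\<Sum>s<n. \<omega>' ^ s * \<zeta> ^ (l * t s))"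
      by (simp add: mult.commute flip: power_mult)
    ultimately show ?thesis using twisted[OF l(1)] by simp
  qed

  obtain i where i: "i < f" "\<omega>' = \<omega> ^ (p ^ i)"
  proof (cases "\<omega> = 1")
    case True
    have "\<omega>' = 1"
      by (rule twisted_sums_eq_imp_nontrivial[OF n roots(2) p \<zeta> \<open>n \<noteq> p\<close> t_less])
        (use eq True in simp)
    then show thesis using that[OF f_pos] True by simp
  next
    case False
    obtain j where j: "\<omega>' = \<omega> ^ j"
      using root_of_unity_power_of_prime_order[OF n roots(1) False roots(2)] by blast
    \<comment> \<open>The trivial case with \<omega> and \<omega>' exchanged; it makes
      \<open>j\<close> invertible modulo \<open>n\<close>.\<close>
    have "\<omega>' \<noteq> 1"
    proof
      assume "\<omega>' = 1"
      then have "\<omega> = 1"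
        using eq twisted_sums_eq_imp_nontrivial[OF n roots(1) p \<zeta> \<open>n \<noteq> p\<close>, of t] t_less by simp
      with False show False ..
    qed
    then have "coprime j n"
      using power_eq_1_iff_dvd_prime[OF n roots(1) False, of j]
      by (simp add: j prime_coprime_right_iff[OF n])
    have "t (j * s) = t s" for s
      by (rule twisted_sums_eq_imp_invariant[OF n roots(1) False \<open>coprime j n\<close> p \<zeta> \<open>n \<noteq> p\<close> t_less t_cong])
        (use eq j in simp_all)
    \<comment> \<open>Equality of traces, read as a relation between power sums of \<open>u\<close>
      in the finite field itself.\<close>
    then have "(\<Sum>i<f. u ^ (s * p ^ i)) = (\<Sum>i<f. u ^ (j * s * p ^ i))" for s
      unfolding t_eq_iff field_trace_u by metis
    then obtain i where "i < f" "[p ^ i = j] (mod n)"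
      using frobenius_exponent_of_power_sums_eq[OF n u_order of_nat_n_nz p_gt_1 p_power_less_n f_pos \<open>coprime j n\<close>]
      by metis
    then show thesis
      using that power_cong_exponent[OF roots(1)] j by metis
  qed

  have "chi' a = chi (a ^ (p ^ i))" if a: "a \<in> UNIV - {0}" for a
  proof -
    obtain s r where sr: "a = u ^ s * v ^ r" using a decompose by blast
    \<comment> \<open>The Frobenius power fixes the factor \<open>v ^ r\<close>, where the
      characters agree, and on the factor \<open>u ^ s\<close> it turns \<omega> into
      \<omega>'.\<close>
    have "(v ^ r) ^ (p ^ i) = v ^ r"
      using v_power_of_nat[of r] of_nat_power_prime[OF p card] by metis
    then have "chi (a ^ (p ^ i)) = chi ((u ^ s) ^ (p ^ i)) * chi (v ^ r)"
      using u_nz v_nz by (simp add: sr power_mult_distrib chi(3))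
    also have "chi ((u ^ s) ^ (p ^ i)) = \<omega>' ^ s"
      using u_nz by (simp add: chi(2) i(2) \<omega>_def mult.commute flip: power_mult)
    also have "chi (v ^ r) = chi' (v ^ r)" by (rule chi_v)
    also have "\<omega>' ^ s * chi' (v ^ r) = chi' a"
      using u_nz v_nz by (simp add: sr \<omega>'_def chi'(2,3))
    finally show ?thesis ..
  qed
  moreover have "(\<lambda>a::'a. a ^ (p ^ i)) \<in> Gal"
    unfolding Gal_eq_frobenius_powers(1)[OF p card f_pos] using i(1) by blast
  ultimately show ?thesis unfolding frobenius_conjugate_def by (intro bexI) auto
qed

end
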